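(* The online algorithm Pseudo-BAF for Colored Bin Packing is absolutely $3.5$-competitive, i.e., it uses at most $3.5\cdot\mathrm{OPT}(L)$ bins on every input $L$. If all items have size at most $1/d$ for a real $d\ge 2$, it uses at most $\lceil (1.5 + d/(d-1))\,\mathrm{OPT}(L)\rceil$ bins. Moreover, the analysis is asymptotically tight.
   Context: Colored Bin Packing: items arrive as a sequence; each item has a size in $[0,1]$ and a color from a finite set $C$. A packing places items into unit-capacity bins, items in a bin ordered by arrival; it is valid if each bin has total size at most $1$ and no two consecutive items in a bin share a color. $\mathrm{OPT}(L)$ is the minimum number of bins in a valid packing of $L$ without reordering. The top item of a bin is its last item; a $c$-bin is a bin whose top item has color $c$. BAF (Balancing Any Fit) is the following online algorithm for items treated as having size zero, using these quantities evaluated before the incoming item (items so far indexed $1,\dots,k$): $s_{c,\ell}=1$ if item $\ell$ has color $c$ and $-1$ otherwise; $D=\max_c\max_{1\le i\le j\le k}\sum_{\ell=i}^j s_{c,\ell}$; $N_c$ = number of $c$-bins; $\mathrm{CD}_c=\max_{i\le k+1}\sum_{\ell=i}^k s_{c,\ell}$ (empty sum $=0$). For an incoming item of color $c$: (1) if there are no bins or all bins are $c$-bins, open a new bin for it; (2) otherwise, if at most one color $c''$ has $N_{c''}>\lceil D/2\rceil$, put it into a bin of a color $c'\ne c$ maximizing $N_{c'}$ among colors $\neq c$ (ties arbitrary); (3) otherwise, with $b,w$ the two colors having $N_b,N_w>\lceil D/2\rceil$: if $c=w$ put it into a $b$-bin, if $c=b$ into a $w$-bin, and if $c\notin\{b,w\}$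 into a $w$-bin when $N_b-\lceil D/2\rceil<\mathrm{CD}_b$ and into a $b$-bin otherwise. Pseudo-BAF: each incoming item is first assigned to a pseudo bin (a bin of unbounded capacity) by running BAF on the pseudo bins, treating the item as having size zero. Within each pseudo bin, the items assigned to it are packed into real unit-capacity bins by Next Fit: the item goes into the current (most recent) real bin of that pseudo bin if the total size stays at most $1$, otherwise a new real bin is opened for that pseudo bin and becomes its current one. The algorithm's cost is the total number of real bins. "Asymptotically tight" means there are inputs on which the number of bins used divided by $\mathrm{OPT}$ tends to the stated ratio as $\mathrm{OPT}\to\infty$. *)

theory Defs
  imports "HOL-Analysis.Analysis"
begin

text \<open>An item is a pair of its colour and its size. The finite set of colours is the type
  \<^typ>\<open>'c\<close> of class \<^class>\<open>finite\<close>. Items, bins and packings use positions \<open>0, \<dots>, k - 1\<close>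
  where the mathematical text indexes items \<open>1, \<dots>, k\<close>.\<close>

type_synonym 'c item = "'c \<times> real"

definition valid_input :: "'c item list \<Rightarrow> bool" where
  "valid_input L \<longleftrightarrow> (\<forall>x\<in>set L. 0 \<le> snd x \<and> snd x \<le> 1)"

definition total_size :: "'c item list \<Rightarrow> real" where
  "total_size B = sum_list (map snd B)"


subsection \<open>Packings and the offline optimum\<close>

text \<open>A packing of a sequence \<open>xs\<close> is a map \<open>p\<close> from positions to bin names; its values at
  positions \<open>\<ge> length xs\<close> are irrelevant.\<close>

definition used_bins :: "(nat \<Rightarrow> nat) \<Rightarrow> 'a list \<Rightarrow> nat set" where
  "used_bins p xs = p ` {..<length xs}"

definition bin_items :: "(nat \<Rightarrow> nat) \<Rightarrow> 'a list \<Rightarrow> nat \<Rightarrow> 'a list" where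
  "bin_items p xs b = nths xs {i. p i = b}"

definition valid_packing :: "'c item list \<Rightarrow> (nat \<Rightarrow> nat) \<Rightarrow> bool" where
  "valid_packing L p \<longleftrightarrow>
     (\<forall>b\<in>used_bins p L. total_size (bin_items p L b) \<le> 1 \<and>
        successively (\<lambda>x y. fst x \<noteq> fst y) (bin_items p L b))"

definition OPT :: "'c item list \<Rightarrow> nat" where
  "OPT L = (LEAST n. \<exists>p. valid_packing L p \<and> card (used_bins p L) = n)"


subsection \<open>Balancing Any Fit\<close>

definition color_sign :: "'c \<Rightarrow> 'c \<Rightarrow> int" where
  "color_sign c x = (if x = c then 1 else -1)"

text \<open>The value for the empty sequence is irrelevant: the rule below consults it only when there
  is already a bin.\<close>

definition discrepancy :: "'c::finite list \<Rightarrow> int" where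
  "discrepancy cs =
     Max {(\<Sum>l=i..j. color_sign c (cs ! l)) | c i j. i \<le> j \<and> j < length cs}"

definition current_discrepancy :: "'c list \<Rightarrow> 'c \<Rightarrow> int" where
  "current_discrepancy cs c =
     Max {(\<Sum>l=i..<length cs. color_sign c (cs ! l)) | i. i \<le> length cs}"

definition c_bins :: "(nat \<Rightarrow> nat) \<Rightarrow> 'c list \<Rightarrow> 'c \<Rightarrow> nat set" where
  "c_bins p cs c = {b \<in> used_bins p cs. last (bin_items p cs b) = c}"

definition num_c_bins :: "(nat \<Rightarrow> nat) \<Rightarrow> 'c list \<Rightarrow> 'c \<Rightarrow> int" where
  "num_c_bins p cs c = int (card (c_bins p cs c))"

definition half_discrepancy :: "'c::finite list \<Rightarrow> int" where
  "half_discrepancy cs = \<lceil>real_of_int (discrepancy cs) / 2\<rceil>"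

definition heavy_colors :: "(nat \<Rightarrow> nat) \<Rightarrow> 'c::finite list \<Rightarrow> 'c set" where
  "heavy_colors p cs = {x. num_c_bins p cs x > half_discrepancy cs}"

text \<open>\<open>baf_step p cs c t\<close>: after the colours \<open>cs\<close> have been packed according to \<open>p\<close>, the algorithm
  may put an incoming item of colour \<open>c\<close> into bin \<open>t\<close>. All unspecified choices are left open: ties,
  the bin among those of the chosen colour, the name of a new bin, and which of the two heavy
  colours is called \<open>b\<close> and which \<open>w\<close>.\<close>

definition baf_step :: "(nat \<Rightarrow> nat) \<Rightarrow> 'c::finite list \<Rightarrow> 'c \<Rightarrow> nat \<Rightarrow> bool" where
  "baf_step p cs c t \<longleftrightarrow>
     (if used_bins p cs = c_bins p cs c then t \<notin> used_bins p cs
      else if card (heavy_colors p cs) \<le> 1 then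
        (\<exists>c'. c' \<noteq> c \<and> (\<forall>x. x \<noteq> c \<longrightarrow> num_c_bins p cs x \<le> num_c_bins p cs c') \<and>
           t \<in> c_bins p cs c')
      else
        (\<exists>b w. b \<noteq> w \<and> b \<in> heavy_colors p cs \<and> w \<in> heavy_colors p cs \<and>
           t \<in> c_bins p cs
             (if c = w then b
              else if c = b then w
              else if num_c_bins p cs b - half_discrepancy cs < current_discrepancy cs b then w
              else b)))"

text \<open>A deterministic online rule \<open>A\<close> for items of size zero maps the colours of the previous items
  and the colour of the incoming item to a bin. \<open>is_BAF A\<close> says that \<open>A\<close> is Balancing Any Fit with
  some way of resolving the open choices.\<close>

definition assignment :: "('c list \<Rightarrow> 'c \<Rightarrow> nat) \<Rightarrow> 'c list \<Rightarrow> nat \<Rightarrow> nat" where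
  "assignment A cs i = A (take i cs) (cs ! i)"

definition is_BAF :: "('c::finite list \<Rightarrow> 'c \<Rightarrow> nat) \<Rightarrow> bool" where
  "is_BAF A \<longleftrightarrow> (\<forall>cs c. baf_step (assignment A cs) cs c (A cs c))"


subsection \<open>Pseudo-BAF\<close>

text \<open>\<open>next_fit_aux B xs\<close> continues Next Fit with current bin \<open>B\<close>.\<close>

fun next_fit_aux :: "'c item list \<Rightarrow> 'c item list \<Rightarrow> 'c item list list" where
  "next_fit_aux B [] = [B]"
| "next_fit_aux B (x # xs) =
     (if total_size B + snd x \<le> 1 then next_fit_aux (B @ [x]) xs
      else B # next_fit_aux [x] xs)"

fun next_fit :: "'c item list \<Rightarrow> 'c item list list" where
  "next_fit [] = []"
| "next_fit (x # xs) = next_fit_aux [x] xs"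

definition pseudo_BAF :: "('c list \<Rightarrow> 'c \<Rightarrow> nat) \<Rightarrow> 'c item list \<Rightarrow> nat" where
  "pseudo_BAF A L =
     (let p = assignment A (map fst L)
      in \<Sum>b\<in>used_bins p L. length (next_fit (bin_items p L b)))"

end

theory Submission
  imports Defs
begin

text \<open>Upper bounds. Write \<open>N\<^sub>x\<close> for the number of \<open>x\<close>-bins, \<open>h = \<lceil>D/2\<rceil>\<close> and \<open>f\<^sub>x = N\<^sub>x - h\<close>. Balancing Any
  Fit maintains \<open>f\<^sub>x \<le> CD\<^sub>x\<close> for every colour and \<open>2 (f\<^sub>x + f\<^sub>y) - 1 \<le> CD\<^sub>x + CD\<^sub>y\<close> for every two
  colours; as long as there are at most \<open>D + h\<close> bins, no three colours have \<open>f\<^sub>x + f\<^sub>y + f\<^sub>z > 0\<close>. A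
  bin is opened only if all bins have the colour \<open>x\<close> of the new item, and then \<open>f\<^sub>x \<le> CD\<^sub>x \<le> D\<close> gives
  at most \<open>D + h = \<lceil>3D/2\<rceil>\<close> bins. Moreover \<open>D \<le> OPT\<close>, the total size is at most \<open>OPT\<close>, and Next Fit uses
  at most \<open>1 + 2s\<close> bins, respectively \<open>1 + s d/(d-1)\<close> bins, for a pseudo bin of total size \<open>s\<close>.

  Tightness. Items of colours alternating between \<open>b\<close> and \<open>c\<close> all go into a single pseudo bin, where
  they can make Next Fit waste space in every bin, while the offline packing fills about \<open>n\<close> bins
  completely. Then items of size zero force about \<open>3n/2\<close> pseudo bins: repeatedly, \<open>n\<close> items of a
  colour on top of at least a third of the pseudo bins arrive, followed by \<open>n\<close> items of the other two
  colours that reset the discrepancy. The case \<open>d = 2\<close> also gives the ratio \<open>3.5\<close>.\<close>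


section \<open>Packings\<close>

lemma used_bins_Nil [simp]: "used_bins p [] = {}"
  by (simp add: used_bins_def)

lemma bin_items_Nil [simp]: "bin_items p [] b = []"
  by (simp add: bin_items_def)

lemma finite_used_bins [simp]: "finite (used_bins p xs)"
  by (simp add: used_bins_def)

lemma used_bins_snoc [simp]:
  "used_bins p (xs @ [x]) = insert (p (length xs)) (used_bins p xs)"
  by (auto simp: used_bins_def lessThan_Suc)

lemma bin_items_append:
  "bin_items p (xs @ ys) b = bin_items p xs b @ bin_items (\<lambda>i. p (i + length xs)) ys b"
  by (simp add: bin_items_def nths_append)

lemma bin_items_snoc [simp]:
  "bin_items p (xs @ [x]) b = bin_items p xs b @ (if p (length xs) = b then [x] else [])"
  by (simp add: bin_items_def nths_append)

lemma used_bins_map [simp]: "used_bins p (map f xs) = used_bins p xs"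
  by (simp add: used_bins_def)

lemma used_bins_cong:
  assumes "\<And>i. i < length xs \<Longrightarrow> p i = q i"
  shows "used_bins p xs = used_bins q xs"
  using assms by (auto simp: used_bins_def image_def)

lemma bin_items_cong:
  assumes "\<And>i. i < length xs \<Longrightarrow> p i = q i"
  shows "bin_items p xs b = bin_items q xs b"
  using assms by (induction xs rule: rev_induct) auto

lemma bin_items_eq_Nil_iff: "bin_items p xs b = [] \<longleftrightarrow> b \<notin> used_bins p xs"
  by (induction xs rule: rev_induct) auto

lemma set_bin_items_subset: "set (bin_items p xs b) \<subseteq> set xs"
  by (induction xs rule: rev_induct) auto

lemma bin_items_single:
  assumes "used_bins p xs \<subseteq> {b}"
  shows "bin_items p xs b = xs"
  using assms by (induction xs rule: rev_induct) auto

lemma sum_list_bin_items: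
  fixes f :: "'a \<Rightarrow> 'b::comm_monoid_add"
  assumes "finite B" "used_bins p xs \<subseteq> B"
  shows "(\<Sum>b\<in>B. sum_list (map f (bin_items p xs b))) = sum_list (map f xs)"
  using assms(2)
proof (induction xs rule: rev_induct)
  case (snoc x xs)
  have "(\<Sum>b\<in>B. sum_list (map f (bin_items p (xs @ [x]) b)))
      = (\<Sum>b\<in>B. sum_list (map f (bin_items p xs b)) + (if p (length xs) = b then f x else 0))"
    by (intro sum.cong) auto
  also have "\<dots> = sum_list (map f xs) + f x"
    using snoc assms(1) by (simp add: sum.distrib sum.delta')
  finally show ?case by simp
qed simp

section \<open>Total size and the offline optimum\<close>

lemma total_size_Nil [simp]: "total_size [] = 0"
  by (simp add: total_size_def)

lemma total_size_Cons [simp]: "total_size (x # xs) = snd x + total_size xs"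
  by (simp add: total_size_def)

lemma total_size_append [simp]: "total_size (xs @ ys) = total_size xs + total_size ys"
  by (simp add: total_size_def)

lemma total_size_nonneg:
  assumes "\<And>x. x \<in> set xs \<Longrightarrow> 0 \<le> snd x"
  shows "0 \<le> total_size xs"
  using assms by (auto simp: total_size_def intro!: sum_list_nonneg)

lemma OPT_le: "valid_packing L p \<Longrightarrow> OPT L \<le> card (used_bins p L)"
  unfolding OPT_def by (rule Least_le) blast

text \<open>Giving every item its own bin is a valid packing, so the minimum that defines
  \<open>OPT\<close> is attained.\<close>

lemma OPT_packing:
  assumes "valid_input L"
  obtains p where "valid_packing L p" "card (used_bins p L) = OPT L"
proof -
  have single: "bin_items (\<lambda>i. i) L b = (if b < length L then [L ! b] else [])" for b
    by (induction L rule: rev_induct) (auto simp: nth_append)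
  have "valid_packing L (\<lambda>i. i)"
    using assms by (auto simp: valid_packing_def valid_input_def single)
  hence "\<exists>n p. valid_packing L p \<and> card (used_bins p L) = n"
    by blast
  from LeastI_ex[OF this] show ?thesis
    using that unfolding OPT_def by blast
qed

lemma total_size_le_OPT:
  assumes "valid_input L"
  shows "total_size L \<le> real (OPT L)"
proof -
  obtain p where p: "valid_packing L p" "card (used_bins p L) = OPT L"
    using OPT_packing[OF assms] .
  have "total_size L = (\<Sum>b\<in>used_bins p L. total_size (bin_items p L b))"
    unfolding total_size_def by (rule sum_list_bin_items[symmetric]) auto
  also have "\<dots> \<le> (\<Sum>b\<in>used_bins p L. 1)"
    using p(1) by (intro sum_mono) (auto simp: valid_packing_def)
  finally show ?thesis using p(2) by simp
qed


section \<open>Discrepancy\<close>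

text \<open>Every \<open>c\<close> that is not at the head is cancelled by its predecessor, which
  has another colour; only a leading \<open>c\<close> remains. The dependence on the head is what
  the induction needs.\<close>

lemma sum_list_color_sign_le:
  assumes "successively (\<noteq>) cs"
  shows "sum_list (map (color_sign c) cs) \<le> (if cs \<noteq> [] \<and> hd cs = c then 1 else 0)"
  using assms
  by (induction cs rule: induct_list012) (auto simp: color_sign_def split: if_splits)

lemma sum_list_drop_take:
  fixes f :: "'a \<Rightarrow> 'b::comm_monoid_add"
  assumes "i \<le> j" "j \<le> length xs"
  shows "sum_list (map f (drop i (take j xs))) = (\<Sum>l=i..<j. f (xs ! l))"
proof -
  have "sum_list (map f (drop i (take j xs))) = (\<Sum>l=0..<j-i. f (xs ! (i + l)))"
    using assms by (auto simp: sum_list_sum_nth min_def intro!: sum.cong)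
  also have "\<dots> = (\<Sum>l=i..<j. f (xs ! l))"
    by (rule sum.reindex_bij_witness[of _ "\<lambda>l. l - i" "\<lambda>l. i + l"]) auto
  finally show ?thesis .
qed

lemma finite_discrepancy_set:
  "finite {(\<Sum>l=i..j. color_sign c (cs ! l)) | (c::'c::finite) i j. i \<le> j \<and> j < length cs}"
proof -
  have "{(\<Sum>l=i..j. color_sign c (cs ! l)) | (c::'c::finite) i j. i \<le> j \<and> j < length cs}
    \<subseteq> (\<lambda>(c, i, j). (\<Sum>l=i..j. color_sign c (cs ! l))) ` (UNIV \<times> {..<length cs} \<times> {..<length cs})"
    by (force simp: image_def)
  thus ?thesis by (rule finite_subset) auto
qed

lemma discrepancy_ge:
  fixes cs :: "'c::finite list"
  assumes "i \<le> j" "j < length cs"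
  shows "(\<Sum>l=i..j. color_sign c (cs ! l)) \<le> discrepancy cs"
  unfolding discrepancy_def using assms by (intro Max_ge finite_discrepancy_set) blast

lemma discrepancy_attained:
  fixes cs :: "'c::finite list"
  assumes "cs \<noteq> []"
  obtains c i j where "i \<le> j" "j < length cs"
    "discrepancy cs = (\<Sum>l=i..j. color_sign c (cs ! l))"
proof -
  have "discrepancy cs \<in>
      {(\<Sum>l=i..j. color_sign c (cs ! l)) | (c::'c::finite) i j. i \<le> j \<and> j < length cs}"
    unfolding discrepancy_def using assms by (intro Max_in finite_discrepancy_set) auto
  thus ?thesis using that by blast
qed

lemma discrepancy_ge_1: "cs \<noteq> [] \<Longrightarrow> 1 \<le> discrepancy cs"
  using discrepancy_ge[of 0 0 cs "cs ! 0"] by (simp add: color_sign_def)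

lemma discrepancy_snoc_mono:
  fixes cs :: "'c::finite list"
  assumes "cs \<noteq> []"
  shows "discrepancy cs \<le> discrepancy (cs @ [x])"
proof -
  obtain c i j where ij: "i \<le> j" "j < length cs"
    "discrepancy cs = (\<Sum>l=i..j. color_sign c (cs ! l))"
    using discrepancy_attained[OF assms] .
  have "(\<Sum>l=i..j. color_sign c (cs ! l)) = (\<Sum>l=i..j. color_sign c ((cs @ [x]) ! l))"
    using ij by (intro sum.cong) (auto simp: nth_append)
  thus ?thesis using ij discrepancy_ge[of i j "cs @ [x]" c] by simp
qed

text \<open>Within each bin of a valid packing, the items of a window alternate between \<open>c\<close> and other
  colours often enough that the bin contributes at most one to the discrepancy of the window.\<close>

lemma discrepancy_le_card_bins:
  assumes "valid_packing L p" "L \<noteq> []"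
  shows "discrepancy (map fst L) \<le> int (card (used_bins p L))"
proof -
  obtain c i j where ij: "i \<le> j" "j < length L"
    "discrepancy (map fst L) = (\<Sum>l=i..j. color_sign c (map fst L ! l))"
    using discrepancy_attained[of "map fst L" thesis] assms(2) by simp
  define W where "W = drop i (take (Suc j) L)"
  define q where "q = (\<lambda>l. p (l + i))"
  have L: "L = (take i L @ W) @ drop (Suc j) L"
    using ij unfolding W_def
    by (metis append_take_drop_id le_Suc_eq min.absorb1 take_take)
  have len: "length (take i L) = i" "length W = Suc j - i"
    using ij by (auto simp: W_def)
  have q_used: "used_bins q W \<subseteq> used_bins p L"
    using ij by (auto simp: used_bins_def q_def len)
  \<comment> \<open>The items of a bin that lie in the window form a contiguous piece of that bin,
    so they inherit the absence of equal neighbours.\<close>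
  have alt: "successively (\<noteq>) (map fst (bin_items q W b))" if "b \<in> used_bins p L" for b
  proof -
    have "successively (\<lambda>x y. fst x \<noteq> fst y) (bin_items p L b)"
      using assms(1) that by (auto simp: valid_packing_def)
    hence "successively (\<lambda>x y. fst x \<noteq> fst y) (bin_items q W b)"
      unfolding q_def using len(1)
      by (subst (asm) L) (auto simp: bin_items_append successively_append_iff)
    thus ?thesis by (simp add: successively_map)
  qed
  have "discrepancy (map fst L) = sum_list (map (\<lambda>x. color_sign c (fst x)) W)"
    using ij sum_list_drop_take[of i "Suc j" L "\<lambda>x. color_sign c (fst x)"]
    by (simp add: W_def atLeastLessThanSuc_atLeastAtMost)
  also have "\<dots> = (\<Sum>b\<in>used_bins p L. sum_list (map (\<lambda>x. color_sign c (fst x)) (bin_items q W b)))"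
    by (rule sum_list_bin_items[symmetric, OF _ q_used]) simp
  also have "\<dots> \<le> (\<Sum>b\<in>used_bins p L. 1)"
  proof (rule sum_mono)
    fix b assume "b \<in> used_bins p L"
    from sum_list_color_sign_le[OF alt[OF this], of c]
    show "sum_list (map (\<lambda>x. color_sign c (fst x)) (bin_items q W b)) \<le> 1"
      by (simp add: comp_def split: if_splits)
  qed
  finally show ?thesis by simp
qed

lemma discrepancy_le_OPT:
  assumes "valid_input L" "L \<noteq> []"
  shows "discrepancy (map fst L) \<le> int (OPT L)"
proof -
  obtain p where "valid_packing L p" "card (used_bins p L) = OPT L"
    using OPT_packing[OF assms(1)] .
  thus ?thesis using discrepancy_le_card_bins[of L p] assms(2) by simp
qed

section \<open>Rounding and current discrepancy\<close>

lemma half_discrepancy_bounds: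
  "discrepancy cs \<le> 2 * half_discrepancy cs" "2 * half_discrepancy cs \<le> discrepancy cs + 1"
  unfolding half_discrepancy_def by linarith+

lemma half_discrepancy_snoc_mono:
  "cs \<noteq> [] \<Longrightarrow> half_discrepancy cs \<le> half_discrepancy (cs @ [x])"
  unfolding half_discrepancy_def using discrepancy_snoc_mono[of cs x] by (intro ceiling_mono) simp

text \<open>A nonempty suffix of the longer sequence is a suffix of the old one, possibly empty,
  followed by the new sign; the empty suffix contributes the 0.\<close>

lemma current_discrepancy_snoc:
  "current_discrepancy (cs @ [x]) c = max 0 (current_discrepancy cs c + color_sign c x)"
proof -
  define S where "S = {(\<Sum>l=i..<length cs. color_sign c (cs ! l)) | i. i \<le> length cs}"
  have S: "finite S" "S \<noteq> {}"
    unfolding S_def by auto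
  have eq: "(\<Sum>l=i..<length cs. color_sign c ((cs @ [x]) ! l)) = (\<Sum>l=i..<length cs. color_sign c (cs ! l))" for i
    by (intro sum.cong) (auto simp: nth_append)
  have "{(\<Sum>l=i..<length (cs @ [x]). color_sign c ((cs @ [x]) ! l)) | i. i \<le> length (cs @ [x])}
      = insert 0 ((\<lambda>s. s + color_sign c x) ` S)" (is "?lhs = ?rhs")
  proof (intro equalityI subsetI)
    fix s assume "s \<in> ?lhs"
    then obtain i where i: "i \<le> Suc (length cs)"
      "s = (\<Sum>l=i..<Suc (length cs). color_sign c ((cs @ [x]) ! l))" by auto
    show "s \<in> ?rhs"
      using i by (cases "i = Suc (length cs)") (auto simp: S_def image_def eq)
  next
    fix s assume "s \<in> ?rhs"
    then consider "s = 0" | i where "i \<le> length cs"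
      "s = (\<Sum>l=i..<length cs. color_sign c (cs ! l)) + color_sign c x"
      by (auto simp: S_def)
    thus "s \<in> ?lhs"
    proof cases
      case 1
      thus ?thesis by (auto intro!: exI[of _ "Suc (length cs)"])
    next
      case (2 i)
      thus ?thesis by (auto intro!: exI[of _ i] simp: eq)
    qed
  qed
  hence "current_discrepancy (cs @ [x]) c = Max (insert 0 ((\<lambda>s. s + color_sign c x) ` S))"
    unfolding current_discrepancy_def by simp
  also have "\<dots> = max 0 (Max ((\<lambda>s. s + color_sign c x) ` S))"
    using S by (intro Max_insert) auto
  also have "Max ((\<lambda>s. s + color_sign c x) ` S) = Max S + color_sign c x"
    using Max_add_commute[OF S, of "\<lambda>s. s"] by simp
  finally show ?thesis by (simp add: current_discrepancy_def S_def)
qed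

lemma current_discrepancy_Nil [simp]: "current_discrepancy [] c = 0"
  by (simp add: current_discrepancy_def)

lemma current_discrepancy_nonneg: "0 \<le> current_discrepancy cs c"
  by (cases cs rule: rev_cases) (auto simp: current_discrepancy_snoc)

text \<open>Nonempty suffixes are among the windows of the discrepancy. The empty suffix is not, but
  its sum 0 is below the value 1 of a window of length one.\<close>

lemma current_discrepancy_le:
  fixes cs :: "'c::finite list"
  assumes "cs \<noteq> []"
  shows "current_discrepancy cs c \<le> discrepancy cs"
proof -
  have "(\<Sum>l=i..<length cs. color_sign c (cs ! l)) \<le> discrepancy cs" if "i \<le> length cs" for i
  proof (cases "i = length cs")
    case True
    thus ?thesis using discrepancy_ge_1[OF assms] by simp
  next
    case False
    hence "length cs = Suc (length cs - 1)" "i \<le> length cs - 1"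
      using that by linarith+
    thus ?thesis using discrepancy_ge[of i "length cs - 1" cs c]
      by (metis atLeastLessThanSuc_atLeastAtMost lessI)
  qed
  thus ?thesis unfolding current_discrepancy_def by (subst Max_le_iff) auto
qed


section \<open>Balancing Any Fit\<close>

definition baf_bins :: "('c list \<Rightarrow> 'c \<Rightarrow> nat) \<Rightarrow> 'c list \<Rightarrow> nat set" where
  "baf_bins A cs = used_bins (assignment A cs) cs"

definition baf_tops :: "('c list \<Rightarrow> 'c \<Rightarrow> nat) \<Rightarrow> 'c list \<Rightarrow> 'c \<Rightarrow> nat set" where
  "baf_tops A cs c = c_bins (assignment A cs) cs c"

abbreviation baf_num :: "('c list \<Rightarrow> 'c \<Rightarrow> nat) \<Rightarrow> 'c list \<Rightarrow> 'c \<Rightarrow> int" where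
  "baf_num A cs c \<equiv> num_c_bins (assignment A cs) cs c"

lemma baf_num_eq: "baf_num A cs c = int (card (baf_tops A cs c))"
  by (simp add: num_c_bins_def baf_tops_def)

lemma assignment_append: "i < length cs \<Longrightarrow> assignment A (cs @ ds) i = assignment A cs i"
  by (simp add: assignment_def nth_append)

lemma assignment_snoc: "assignment A (cs @ [c]) (length cs) = A cs c"
  by (simp add: assignment_def)

lemma baf_bins_Nil [simp]: "baf_bins A [] = {}"
  by (simp add: baf_bins_def)

lemma finite_baf_bins [simp]: "finite (baf_bins A cs)"
  by (simp add: baf_bins_def)

lemma baf_tops_subset: "baf_tops A cs c \<subseteq> baf_bins A cs"
  by (auto simp: baf_tops_def baf_bins_def c_bins_def)

lemma finite_baf_tops [simp]: "finite (baf_tops A cs c)"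
  by (rule finite_subset[OF baf_tops_subset]) simp

lemma baf_tops_disjoint: "x \<noteq> y \<Longrightarrow> baf_tops A cs x \<inter> baf_tops A cs y = {}"
  by (auto simp: baf_tops_def c_bins_def)

lemma baf_bins_snoc: "baf_bins A (cs @ [c]) = insert (A cs c) (baf_bins A cs)"
proof -
  have "used_bins (assignment A (cs @ [c])) cs = used_bins (assignment A cs) cs"
    by (rule used_bins_cong) (simp add: assignment_append)
  thus ?thesis by (simp add: baf_bins_def assignment_snoc)
qed

lemma baf_tops_snoc:
  "baf_tops A (cs @ [c]) x =
     (if x = c then insert (A cs c) (baf_tops A cs c) else baf_tops A cs x - {A cs c})"
proof -
  have u: "used_bins (assignment A (cs @ [c])) cs = used_bins (assignment A cs) cs"
    by (rule used_bins_cong) (simp add: assignment_append)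
  have b: "bin_items (assignment A (cs @ [c])) cs b = bin_items (assignment A cs) cs b" for b
    by (rule bin_items_cong) (simp add: assignment_append)
  show ?thesis
    by (auto simp: baf_tops_def c_bins_def u b assignment_snoc)
qed

lemma baf_bins_append_mono: "baf_bins A cs \<subseteq> baf_bins A (cs @ ds)"
proof (induction ds rule: rev_induct)
  case (snoc d ds)
  thus ?case using baf_bins_snoc[of A "cs @ ds" d] by auto
qed simp

lemma baf_num_sum3:
  assumes "x \<noteq> y" "x \<noteq> z" "y \<noteq> z"
  shows "baf_num A cs x + baf_num A cs y + baf_num A cs z \<le> int (card (baf_bins A cs))"
proof -
  have "card ((baf_tops A cs x \<union> baf_tops A cs y) \<union> baf_tops A cs z) \<le> card (baf_bins A cs)"
    by (intro card_mono Un_least baf_tops_subset) simp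
  moreover have "card ((baf_tops A cs x \<union> baf_tops A cs y) \<union> baf_tops A cs z)
      = card (baf_tops A cs x) + card (baf_tops A cs y) + card (baf_tops A cs z)"
    using assms baf_tops_disjoint[of _ _ A cs]
    by (subst card_Un_disjoint, simp_all add: Int_Un_distrib2)
       (subst card_Un_disjoint, auto)
  ultimately show ?thesis by (simp add: baf_num_eq)
qed

text \<open>In each branch of the rule the bin is either new or has a top colour other than
  \<open>c\<close>. Hence every item of colour \<open>c\<close> raises the number of
  \<open>c\<close>-bins by exactly one.\<close>

lemma baf_choice_not_top:
  fixes A :: "'c::finite list \<Rightarrow> 'c \<Rightarrow> nat"
  assumes "is_BAF A"
  shows "A cs c \<notin> baf_tops A cs c"
proof -
  have "baf_step (assignment A cs) cs c (A cs c)"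
    using assms by (simp add: is_BAF_def)
  thus ?thesis
    by (auto simp: baf_step_def baf_tops_def c_bins_def split: if_splits)
qed

lemma baf_choice_used:
  fixes A :: "'c::finite list \<Rightarrow> 'c \<Rightarrow> nat"
  assumes "is_BAF A" "baf_bins A cs \<noteq> baf_tops A cs c"
  shows "A cs c \<in> baf_bins A cs"
proof -
  have "baf_step (assignment A cs) cs c (A cs c)"
    using assms by (simp add: is_BAF_def)
  thus ?thesis using assms(2)
    by (auto simp: baf_step_def baf_tops_def baf_bins_def c_bins_def split: if_splits)
qed

text \<open>One step of the algorithm that opens no bin, in terms of the numbers \<open>N\<close> of bins of each
  colour, the current discrepancies \<open>CD\<close> and \<open>h = \<lceil>D/2\<rceil>\<close>. The invariant for pairs is needed because
  it implies that two heavy colours cannot both be tight in the invariant for single colours.\<close>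

lemma baf_invariant_step:
  fixes N CD :: "'c \<Rightarrow> int" and h :: int
  assumes single: "\<And>x. N x \<le> h + CD x"
    and pair: "\<And>x y. x \<noteq> y \<Longrightarrow> 2 * (N x + N y - 2 * h) - 1 \<le> CD x + CD y"
    and three: "\<And>x y z. x \<noteq> y \<Longrightarrow> x \<noteq> z \<Longrightarrow> y \<noteq> z \<Longrightarrow> N x + N y + N z \<le> 3 * h"
    and nonneg: "\<And>x. 0 \<le> CD x"
    and "c' \<noteq> c"
    and N': "N' c = N c + 1" "N' c' = N c' - 1" "\<And>x. x \<noteq> c \<Longrightarrow> x \<noteq> c' \<Longrightarrow> N' x = N x"
    and CD': "CD' c = CD c + 1" "\<And>x. x \<noteq> c \<Longrightarrow> CD' x = max 0 (CD x - 1)"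
    and rule: "((\<forall>x. x \<noteq> c \<longrightarrow> N x \<le> N c') \<and> (\<forall>x y. h < N x \<longrightarrow> h < N y \<longrightarrow> x = y)) \<or>
      (\<exists>b w. b \<noteq> w \<and> h < N b \<and> h < N w \<and>
         c' = (if c = w then b else if c = b then w else if N b - h < CD b then w else b))"
  shows "\<And>x. N' x \<le> h + CD' x"
    and "\<And>x y. x \<noteq> y \<Longrightarrow> 2 * (N' x + N' y - 2 * h) - 1 \<le> CD' x + CD' y"
proof -
  \<comment> \<open>A colour other than \<open>c\<close> and \<open>c'\<close> keeps its bins while
    its current discrepancy may drop by one. It therefore needs a slack of one, unless it has at
    most \<open>h\<close> bins.\<close>
  have free: "N x \<le> h + CD x - 1 \<or> N x \<le> h" if x: "x \<noteq> c" "x \<noteq> c'" for x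
    using rule
  proof (elim disjE conjE exE)
    assume "\<forall>x. x \<noteq> c \<longrightarrow> N x \<le> N c'" and u: "\<forall>x y. h < N x \<longrightarrow> h < N y \<longrightarrow> x = y"
    hence "N x \<le> N c'" using x by blast
    moreover have "\<not> (h < N x \<and> h < N c')" using u x by blast
    ultimately show ?thesis by linarith
  next
    fix b w
    assume bw: "b \<noteq> w" "h < N b" "h < N w"
      and c': "c' = (if c = w then b else if c = b then w else if N b - h < CD b then w else b)"
    consider "x = b" | "x = w" | "x \<noteq> b" "x \<noteq> w" by blast
    thus ?thesis
    proof cases
      case 1
      thus ?thesis using x c' bw by (auto split: if_splits)
    next
      case 2
      \<comment> \<open>Here the rule preferred \<open>b\<close> to \<open>w\<close>. With
        \<open>f = N - h\<close>, inserting \<open>CD b \<le> f b\<close> into the pair inequality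
        gives \<open>f b + 2 * f w - 1 \<le> CD w\<close>, and \<open>f b\<close>,
        \<open>f w\<close> are both at least 1, so \<open>f w \<le> CD w - 1\<close>.\<close>
      hence "CD b \<le> N b - h" using x c' bw by (auto split: if_splits)
      moreover have "h + 1 \<le> N b" "h + 1 \<le> N w" using bw by auto
      ultimately have "N w \<le> h + CD w - 1" using pair[OF bw(1)] by (simp add: algebra_simps)
      thus ?thesis using 2 by simp
    next
      case 3
      thus ?thesis using three[of x b w] bw by linarith
    qed
  qed
  have CD'_ge: "0 \<le> CD' x" "CD x - 1 \<le> CD' x" if "x \<noteq> c" for x
    using CD'(2)[OF that] by simp_all
  show "N' x \<le> h + CD' x" for x
  proof -
    consider "x = c" | "x = c'" | "x \<noteq> c" "x \<noteq> c'" by blast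
    thus ?thesis
    proof cases
      case 1
      thus ?thesis using single[of c] N'(1) CD'(1) by simp
    next
      case 2
      thus ?thesis using single[of c'] N'(2) CD'_ge[OF \<open>c' \<noteq> c\<close>] by simp
    next
      case 3
      thus ?thesis using free[OF 3] N'(3)[OF 3] CD'_ge[OF 3(1)] by linarith
    qed
  qed
  have with_c: "2 * (N' c + N' y - 2 * h) - 1 \<le> CD' c + CD' y" if "y \<noteq> c" for y
  proof (cases "y = c'")
    case True
    thus ?thesis using pair[of c c'] CD'_ge[OF that] N'(1,2) CD'(1) that by simp
  next
    case False
    \<comment> \<open>If \<open>N y \<le> N c'\<close>, then
      \<open>2 * N y \<le> 3 * h - N c\<close>, so
      \<open>2 * (N c + N y - 2 * h) \<le> N c - h \<le> CD c\<close>. If \<open>c'\<close> is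
      heavy, \<open>N c + N y\<close> is already below \<open>2 * h\<close>.\<close>
    have t: "N c + N y + N c' \<le> 3 * h" using three[of c y c'] that False \<open>c' \<noteq> c\<close> by blast
    have "N y \<le> N c' \<or> h < N c'"
      using rule that by (auto split: if_splits)
    hence "2 * (N c + N y - 2 * h) + 1 \<le> CD c + 1"
    proof
      assume "N y \<le> N c'"
      thus ?thesis using t single[of c] by (simp add: algebra_simps)
    next
      assume "h < N c'"
      thus ?thesis using t nonneg[of c] by (simp add: algebra_simps)
    qed
    thus ?thesis
      using N'(1) N'(3)[OF that False] CD'(1) CD'_ge(1)[OF that] by (simp add: algebra_simps)
  qed
  have without_c: "2 * (N' x + N' y - 2 * h) - 1 \<le> CD' x + CD' y"
    if "x \<noteq> y" "x \<noteq> c" "y \<noteq> c" for x y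
  proof -
    note ge = CD'_ge[OF that(2)] CD'_ge[OF that(3)]
    consider "x = c'" | "y = c'" | "x \<noteq> c'" "y \<noteq> c'" by blast
    thus ?thesis
    proof cases
      case 1
      hence "N' x + N' y = N x + N y - 1" using N'(2) N'(3)[of y] that by simp
      thus ?thesis using pair[OF that(1)] ge by (simp add: algebra_simps)
    next
      case 2
      hence "N' x + N' y = N x + N y - 1" using N'(2) N'(3)[of x] that by simp
      thus ?thesis using pair[OF that(1)] ge by (simp add: algebra_simps)
    next
      case 3
      \<comment> \<open>The colour \<open>c'\<close> either has at least as many bins as
        \<open>x\<close> and \<open>y\<close> each, or is heavy. In both cases \<open>x\<close> and
        \<open>y\<close> share at most \<open>2 * h\<close> of the \<open>3 * h\<close> bins, so the
        left side of the claim is negative.\<close>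
      have t: "N x + N y + N c' \<le> 3 * h" using three[of x y c'] that 3 by blast
      have "(N x \<le> N c' \<and> N y \<le> N c') \<or> h < N c'"
        using rule that by (auto split: if_splits)
      hence "N x + N y \<le> 2 * h" using t by linarith
      thus ?thesis using N'(3)[of x] N'(3)[of y] that 3 ge by simp
    qed
  qed
  show "2 * (N' x + N' y - 2 * h) - 1 \<le> CD' x + CD' y" if "x \<noteq> y" for x y
  proof -
    consider "x = c" | "y = c" | "x \<noteq> c" "y \<noteq> c" by blast
    thus ?thesis
    proof cases
      case 1
      thus ?thesis using with_c[of y] that by simp
    next
      case 2
      thus ?thesis using with_c[of x] that by (simp add: add.commute)
    next
      case 3
      thus ?thesis using without_c that by blast
    qed
  qed
qed

section \<open>The invariant along a run and the number of bins\<close>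

definition baf_invariant :: "('c::finite list \<Rightarrow> 'c \<Rightarrow> nat) \<Rightarrow> 'c list \<Rightarrow> bool" where
  "baf_invariant A cs \<longleftrightarrow>
     int (card (baf_bins A cs)) \<le> discrepancy cs + half_discrepancy cs \<and>
     (\<forall>x. baf_num A cs x \<le> half_discrepancy cs + current_discrepancy cs x) \<and>
     (\<forall>x y. x \<noteq> y \<longrightarrow>
        2 * (baf_num A cs x + baf_num A cs y - 2 * half_discrepancy cs) - 1
          \<le> current_discrepancy cs x + current_discrepancy cs y)"

text \<open>After the step all bins have top colour \<open>c\<close>. The assumption
  \<open>num\<close> is then the single-colour inequality for \<open>c\<close>. Together with
  \<open>CD \<le> D\<close> it bounds the number of bins, and with
  \<open>CD \<le> D \<le> 2 * h\<close> it gives the pair inequality. The lemma serves both the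
  first item and later ones.\<close>

lemma baf_invariant_new_bin:
  fixes A :: "'c::finite list \<Rightarrow> 'c \<Rightarrow> nat"
  assumes all: "baf_bins A cs = baf_tops A cs c" and new: "A cs c \<notin> baf_bins A cs"
    and num: "int (card (baf_bins A cs)) + 1
      \<le> half_discrepancy (cs @ [c]) + current_discrepancy (cs @ [c]) c"
  shows "baf_invariant A (cs @ [c])"
proof -
  let ?ds = "cs @ [c]"
  have ds: "current_discrepancy ?ds c \<le> discrepancy ?ds" "1 \<le> discrepancy ?ds"
    by (simp_all add: current_discrepancy_le discrepancy_ge_1)
  note h = half_discrepancy_bounds(1)[of ?ds]
  have T: "int (card (baf_bins A ?ds)) = int (card (baf_bins A cs)) + 1"
    using new by (simp add: baf_bins_snoc)
  have Nc: "baf_num A ?ds c = int (card (baf_bins A cs)) + 1"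
    using new all by (simp add: baf_num_eq baf_tops_snoc)
  have Nx: "baf_num A ?ds x = 0" if "x \<noteq> c" for x
  proof -
    have "baf_tops A cs x = {}"
      using baf_tops_disjoint[OF that, of A cs] baf_tops_subset[of A cs x] all by blast
    thus ?thesis using that by (simp add: baf_num_eq baf_tops_snoc)
  qed
  have nn: "0 \<le> current_discrepancy ?ds x" for x by (rule current_discrepancy_nonneg)
  have "baf_num A ?ds x \<le> half_discrepancy ?ds + current_discrepancy ?ds x" for x
    using Nc Nx[of x] num nn[of x] h ds by (cases "x = c") auto
  moreover have "2 * (baf_num A ?ds x + baf_num A ?ds y - 2 * half_discrepancy ?ds) - 1
      \<le> current_discrepancy ?ds x + current_discrepancy ?ds y" if "x \<noteq> y" for x y
    using Nc Nx[of x] Nx[of y] num nn[of x] nn[of y] h ds that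
    by (cases "x = c"; cases "y = c") auto
  ultimately show ?thesis
    unfolding baf_invariant_def using T num ds by auto
qed

lemma baf_invariant_snoc:
  fixes A :: "'c::finite list \<Rightarrow> 'c \<Rightarrow> nat"
  assumes A: "is_BAF A" and inv: "baf_invariant A cs" and ne: "cs \<noteq> []"
  shows "baf_invariant A (cs @ [c])"
proof (cases "baf_bins A cs = baf_tops A cs c")
  case True
  have step: "baf_step (assignment A cs) cs c (A cs c)"
    using A by (simp add: is_BAF_def)
  hence new: "A cs c \<notin> baf_bins A cs"
    using True by (simp add: baf_step_def baf_bins_def baf_tops_def)
  have "int (card (baf_bins A cs)) \<le> half_discrepancy cs + current_discrepancy cs c"
    using inv True by (metis baf_invariant_def baf_num_eq)
  \<comment> \<open>The new item raises the number of bins and the current discrepancy of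
    \<open>c\<close> by one each, which preserves the single-colour bound.\<close>
  hence "int (card (baf_bins A cs)) + 1
      \<le> half_discrepancy (cs @ [c]) + current_discrepancy (cs @ [c]) c"
    using half_discrepancy_snoc_mono[OF ne, of c]
    by (simp add: current_discrepancy_snoc color_sign_def)
  thus ?thesis using baf_invariant_new_bin[OF True new] by blast
next
  case False
  let ?N = "baf_num A cs" and ?N' = "baf_num A (cs @ [c])"
  let ?h = "half_discrepancy cs" and ?t = "A cs c"
  let ?CD = "current_discrepancy cs" and ?CD' = "current_discrepancy (cs @ [c])"
  have step: "baf_step (assignment A cs) cs c ?t"
    using A by (simp add: is_BAF_def)
  have heavy: "heavy_colors (assignment A cs) cs = {x. ?h < ?N x}"
    by (simp add: heavy_colors_def)
  obtain c' where c': "c' \<noteq> c" "?t \<in> baf_tops A cs c'"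
    and rule: "((\<forall>x. x \<noteq> c \<longrightarrow> ?N x \<le> ?N c') \<and> (\<forall>x y. ?h < ?N x \<longrightarrow> ?h < ?N y \<longrightarrow> x = y)) \<or>
      (\<exists>b w. b \<noteq> w \<and> ?h < ?N b \<and> ?h < ?N w \<and>
         c' = (if c = w then b else if c = b then w else if ?N b - ?h < ?CD b then w else b))"
  proof (cases "card (heavy_colors (assignment A cs) cs) \<le> 1")
    case True
    hence "\<exists>c'. c' \<noteq> c \<and> (\<forall>x. x \<noteq> c \<longrightarrow> ?N x \<le> ?N c') \<and> ?t \<in> baf_tops A cs c'"
      using step False by (simp add: baf_step_def baf_bins_def baf_tops_def)
    moreover have "\<forall>x y. ?h < ?N x \<longrightarrow> ?h < ?N y \<longrightarrow> x = y"
      using True card_le_Suc0_iff_eq[of "{x. ?h < ?N x}"] by (auto simp: heavy)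
    ultimately show ?thesis using that by blast
  next
    case many: False
    hence "\<exists>b w. b \<noteq> w \<and> ?h < ?N b \<and> ?h < ?N w \<and> ?t \<in> baf_tops A cs
        (if c = w then b else if c = b then w else if ?N b - ?h < ?CD b then w else b)"
      using step False by (simp add: baf_step_def baf_bins_def baf_tops_def heavy)
    then obtain b w where bw: "b \<noteq> w" "?h < ?N b" "?h < ?N w" "?t \<in> baf_tops A cs
        (if c = w then b else if c = b then w else if ?N b - ?h < ?CD b then w else b)"
      by blast
    show ?thesis
      by (rule that[OF _ bw(4)]) (use bw in auto)
  qed
  have bins: "baf_bins A (cs @ [c]) = baf_bins A cs"
    using subsetD[OF baf_tops_subset c'(2)] by (auto simp: baf_bins_snoc)
  have t_other: "?t \<notin> baf_tops A cs x" if "x \<noteq> c'" for x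
    using baf_tops_disjoint[OF that] c'(2) by blast
  have Nc: "?N' c = ?N c + 1"
    using t_other[of c] c' by (auto simp: baf_num_eq baf_tops_snoc)
  have Nc': "?N' c' = ?N c' - 1"
  proof -
    have "0 < card (baf_tops A cs c')" using c'(2) by (auto simp: card_gt_0_iff)
    thus ?thesis
      using c' by (simp add: baf_num_eq baf_tops_snoc of_nat_diff del: card_gt_0_iff)
  qed
  have Nx: "?N' x = ?N x" if "x \<noteq> c" "x \<noteq> c'" for x
    using that t_other[of x] by (simp add: baf_num_eq baf_tops_snoc)
  have CDc: "?CD' c = ?CD c + 1"
    using current_discrepancy_nonneg[of cs c] by (simp add: current_discrepancy_snoc color_sign_def)
  have CDx: "?CD' x = max 0 (?CD x - 1)" if "x \<noteq> c" for x
    using that by (simp add: current_discrepancy_snoc color_sign_def)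
  have inv': "int (card (baf_bins A cs)) \<le> discrepancy cs + ?h"
    "\<And>x. ?N x \<le> ?h + ?CD x"
    "\<And>x y. x \<noteq> y \<Longrightarrow> 2 * (?N x + ?N y - 2 * ?h) - 1 \<le> ?CD x + ?CD y"
    using inv by (auto simp: baf_invariant_def)
  \<comment> \<open>Different colours own disjoint bins, and there are at most
    \<open>D + h \<le> 3 * h\<close> bins.\<close>
  have three: "?N x + ?N y + ?N z \<le> 3 * ?h" if "x \<noteq> y" "x \<noteq> z" "y \<noteq> z" for x y z
    using baf_num_sum3[OF that, of A cs] inv'(1) half_discrepancy_bounds(1)[of cs] by linarith
  have nonneg: "0 \<le> ?CD x" for x by (rule current_discrepancy_nonneg)
  have new1: "?N' x \<le> ?h + ?CD' x" for x
    by (rule baf_invariant_step(1)[where N = ?N and CD = ?CD and c = c and c' = c']; fact)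
  have new2: "2 * (?N' x + ?N' y - 2 * ?h) - 1 \<le> ?CD' x + ?CD' y" if "x \<noteq> y" for x y
    by (rule baf_invariant_step(2)[where N = ?N and CD = ?CD and c = c and c' = c']; fact)
  \<comment> \<open>The step inequalities are stated with the old \<open>h\<close>; a larger
    discrepancy only weakens them.\<close>
  have mono: "discrepancy cs \<le> discrepancy (cs @ [c])" "?h \<le> half_discrepancy (cs @ [c])"
    using ne by (auto intro: discrepancy_snoc_mono half_discrepancy_snoc_mono)
  show ?thesis
    unfolding baf_invariant_def
  proof (intro conjI allI impI)
    show "int (card (baf_bins A (cs @ [c])))
        \<le> discrepancy (cs @ [c]) + half_discrepancy (cs @ [c])"
      using inv'(1) mono by (simp add: bins)
    show "?N' x \<le> half_discrepancy (cs @ [c]) + ?CD' x" for x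
      using new1[of x] mono by linarith
    show "2 * (?N' x + ?N' y - 2 * half_discrepancy (cs @ [c])) - 1 \<le> ?CD' x + ?CD' y"
      if "x \<noteq> y" for x y
      using new2[OF that] mono by (simp add: algebra_simps)
  qed
qed

text \<open>The induction starts with one item because \<open>discrepancy []\<close> is the maximum
  of an empty set.\<close>

lemma baf_invariant:
  fixes A :: "'c::finite list \<Rightarrow> 'c \<Rightarrow> nat"
  assumes "is_BAF A" "cs \<noteq> []"
  shows "baf_invariant A cs"
  using assms(2)
proof (induction cs rule: rev_nonempty_induct)
  case (single c)
  have "1 \<le> half_discrepancy [c] + current_discrepancy [c] c"
    using half_discrepancy_bounds(1)[of "[c]"] discrepancy_ge_1[of "[c]"]
      current_discrepancy_nonneg[of "[c]" c] by simp
  moreover have "baf_tops A [] c = {}"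
    using baf_tops_subset[of A "[]" c] by simp
  ultimately show ?case
    using baf_invariant_new_bin[of A "[]" c] by simp
next
  case (snoc c cs)
  thus ?case using baf_invariant_snoc[OF assms(1)] by blast
qed

text \<open>The bound \<open>D + h\<close> is at most \<open>(3 * D + 1) / 2\<close>, and
  \<open>D \<le> OPT L\<close>; the summand 1 is the loss from rounding \<open>D / 2\<close>
  up.\<close>

lemma card_baf_bins_le:
  fixes A :: "'c::finite list \<Rightarrow> 'c \<Rightarrow> nat"
  assumes "is_BAF A" "valid_input L"
  shows "2 * card (baf_bins A (map fst L)) \<le> 3 * OPT L + 1"
proof (cases "L = []")
  case False
  have "int (card (baf_bins A (map fst L)))
      \<le> discrepancy (map fst L) + half_discrepancy (map fst L)"
    using baf_invariant[OF assms(1), of "map fst L"] False by (simp add: baf_invariant_def)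
  thus ?thesis
    using half_discrepancy_bounds(2)[of "map fst L"] discrepancy_le_OPT[OF assms(2) False]
    by linarith
qed simp


section \<open>Next Fit\<close>

lemma length_next_fit_aux_pos: "1 \<le> length (next_fit_aux B xs)"
  by (induction B xs rule: next_fit_aux.induct) auto

text \<open>A closed bin together with the item that did not fit has size above 1. That item may be
  charged twice, once with the closed bin and once with its own bin; the content of \<open>B\<close>
  is charged only once more, hence its weight 1. The inequality is strict as soon as a bin has been
  closed.\<close>

lemma length_next_fit_aux_le:
  assumes "\<And>x. x \<in> set xs \<Longrightarrow> 0 \<le> snd x" "0 \<le> total_size B"
  shows "length (next_fit_aux B xs) = 1 \<or>
    real (length (next_fit_aux B xs)) < 1 + total_size B + 2 * total_size xs"
  using assms
proof (induction B xs rule: next_fit_aux.induct)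
  case (2 B x xs)
  have nn: "0 \<le> total_size xs" "0 \<le> snd x"
    using 2(3) by (simp_all add: total_size_nonneg)
  show ?case
  proof (cases "total_size B + snd x \<le> 1")
    case True
    have "length (next_fit_aux (B @ [x]) xs) = 1 \<or> real (length (next_fit_aux (B @ [x]) xs))
        < 1 + total_size (B @ [x]) + 2 * total_size xs"
      using 2(1)[OF True] 2(3,4) nn by simp
    thus ?thesis using True nn by auto
  next
    case False
    have "length (next_fit_aux [x] xs) = 1 \<or>
        real (length (next_fit_aux [x] xs)) < 1 + snd x + 2 * total_size xs"
      using 2(2)[OF False] 2(3) nn by simp
    hence "real (length (next_fit_aux [x] xs)) \<le> 1 + snd x + 2 * total_size xs"
      using nn by linarith
    thus ?thesis using False by simp
  qed
qed simp

lemma length_next_fit_le: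
  assumes "\<And>x. x \<in> set xs \<Longrightarrow> 0 \<le> snd x"
  shows "length (next_fit xs) \<le> 1 \<or> real (length (next_fit xs)) < 1 + 2 * total_size xs"
proof (cases xs)
  case (Cons x ys)
  hence "0 \<le> snd x" using assms by simp
  thus ?thesis using length_next_fit_aux_le[of ys "[x]"] assms Cons by (simp, linarith)
qed simp

text \<open>A bin is closed by an item of size at most \<open>1 / d\<close>, so it is filled to at
  least \<open>(d - 1) / d\<close> and pays for itself at the rate
  \<open>d / (d - 1)\<close>.\<close>

lemma length_next_fit_aux_le_small:
  assumes "1 < d" "\<And>x. x \<in> set xs \<Longrightarrow> 0 \<le> snd x \<and> snd x \<le> 1 / d" "0 \<le> total_size B"
  shows "real (length (next_fit_aux B xs)) \<le> 1 + d / (d - 1) * (total_size B + total_size xs)"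
  using assms(2,3)
proof (induction B xs rule: next_fit_aux.induct)
  case (1 B)
  thus ?case using assms(1) by simp
next
  case (2 B x xs)
  show ?case
  proof (cases "total_size B + snd x \<le> 1")
    case True
    thus ?thesis using 2 by (simp add: add.assoc)
  next
    case False
    hence "1 - 1 / d \<le> total_size B" using 2(3)[of x] by simp
    hence "1 \<le> d / (d - 1) * total_size B"
      using assms(1) by (simp add: field_simps)
    moreover have "real (length (next_fit_aux [x] xs))
        \<le> 1 + d / (d - 1) * (total_size [x] + total_size xs)"
      using False 2 by simp
    ultimately show ?thesis using False by (simp add: distrib_left)
  qed
qed

lemma length_next_fit_le_small:
  assumes "1 < d" "\<And>x. x \<in> set xs \<Longrightarrow> 0 \<le> snd x \<and> snd x \<le> 1 / d"
  shows "real (length (next_fit xs)) \<le> 1 + d / (d - 1) * total_size xs"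
proof (cases xs)
  case Nil
  thus ?thesis by simp
next
  case (Cons x ys)
  thus ?thesis using length_next_fit_aux_le_small[of d ys "[x]"] assms by simp
qed


section \<open>Upper bounds\<close>

lemma pseudo_BAF_eq:
  "pseudo_BAF A L = (\<Sum>b\<in>baf_bins A (map fst L).
     length (next_fit (bin_items (assignment A (map fst L)) L b)))"
  by (simp add: pseudo_BAF_def baf_bins_def Let_def)

lemma sum_total_size_bins:
  "(\<Sum>b\<in>baf_bins A (map fst L). total_size (bin_items (assignment A (map fst L)) L b))
     = total_size L"
  unfolding total_size_def by (rule sum_list_bin_items) (auto simp: baf_bins_def)

lemma pseudo_BAF_le:
  fixes A :: "'c::finite list \<Rightarrow> 'c \<Rightarrow> nat"
  assumes "is_BAF A" "valid_input L"
  shows "real (pseudo_BAF A L) \<le> 3.5 * real (OPT L)"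
proof (cases "L = []")
  case True
  thus ?thesis by (simp add: pseudo_BAF_eq)
next
  case False
  define B where "B = baf_bins A (map fst L)"
  define I where "I = bin_items (assignment A (map fst L)) L"
  have cost: "pseudo_BAF A L = (\<Sum>b\<in>B. length (next_fit (I b)))"
    by (simp add: pseudo_BAF_eq B_def I_def)
  have T: "2 * card B \<le> 3 * OPT L + 1"
    using card_baf_bins_le[OF assms] by (simp add: B_def)
  have S: "(\<Sum>b\<in>B. total_size (I b)) \<le> real (OPT L)"
    using sum_total_size_bins[of A L] total_size_le_OPT[OF assms(2)] by (simp add: B_def I_def)
  have nn: "0 \<le> snd x" if "x \<in> set (I b)" for x b
    using that set_bin_items_subset assms(2) by (force simp: I_def valid_input_def)
  have nf: "length (next_fit (I b)) \<le> 1 \<or> real (length (next_fit (I b))) < 1 + 2 * total_size (I b)" for b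
    by (rule length_next_fit_le) (rule nn)
  show ?thesis
  \<comment> \<open>Either the cost is just the number of pseudo bins, or some pseudo bin satisfies
    the strict bound. The strictness turns into \<open>2 * cost < 7 * OPT L + 1\<close>, and
    integrality removes the 1.\<close>
  proof (cases "\<forall>b\<in>B. length (next_fit (I b)) \<le> 1")
    case True
    have "pseudo_BAF A L \<le> (\<Sum>b\<in>B. 1)"
      unfolding cost using True by (intro sum_mono) auto
    moreover have "1 \<le> OPT L"
      using discrepancy_le_OPT[OF assms(2) False] discrepancy_ge_1[of "map fst L"] False by simp
    ultimately show ?thesis using T by simp
  next
    case notall: False
    have "real (pseudo_BAF A L) < (\<Sum>b\<in>B. 1 + 2 * total_size (I b))"
      unfolding cost of_nat_sum
    proof (rule sum_strict_mono_ex1)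
      show "finite B" by (simp add: B_def)
      have "0 \<le> total_size (I b)" for b by (rule total_size_nonneg) (rule nn)
      thus "\<forall>b\<in>B. real (length (next_fit (I b))) \<le> 1 + 2 * total_size (I b)"
        using nf by (smt (verit) of_nat_mono of_nat_1)
      show "\<exists>b\<in>B. real (length (next_fit (I b))) < 1 + 2 * total_size (I b)"
        using notall nf by blast
    qed
    also have "\<dots> = real (card B) + 2 * (\<Sum>b\<in>B. total_size (I b))"
      by (simp add: sum.distrib sum_distrib_left)
    also have "\<dots> \<le> real (card B) + 2 * real (OPT L)"
      using S by simp
    finally have "2 * pseudo_BAF A L < 2 * card B + 4 * OPT L"
      by linarith
    thus ?thesis using T by simp
  qed
qed

lemma pseudo_BAF_le_small:
  fixes A :: "'c::finite list \<Rightarrow> 'c \<Rightarrow> nat" and d :: real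
  assumes "is_BAF A" "valid_input L" "2 \<le> d" "\<And>x. x \<in> set L \<Longrightarrow> snd x \<le> 1 / d"
  shows "int (pseudo_BAF A L) \<le> \<lceil>(1.5 + d / (d - 1)) * real (OPT L)\<rceil>"
proof -
  define B where "B = baf_bins A (map fst L)"
  define I where "I = bin_items (assignment A (map fst L)) L"
  define r where "r = d / (d - 1)"
  have cost: "pseudo_BAF A L = (\<Sum>b\<in>B. length (next_fit (I b)))"
    by (simp add: pseudo_BAF_eq B_def I_def)
  have T: "2 * card B \<le> 3 * OPT L + 1"
    using card_baf_bins_le[OF assms(1,2)] by (simp add: B_def)
  have S: "(\<Sum>b\<in>B. total_size (I b)) \<le> real (OPT L)"
    using sum_total_size_bins[of A L] total_size_le_OPT[OF assms(2)] by (simp add: B_def I_def)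
  have sz: "0 \<le> snd x \<and> snd x \<le> 1 / d" if "x \<in> set (I b)" for x b
  proof -
    have "x \<in> set L" using subsetD[OF set_bin_items_subset] that by (simp add: I_def)
    thus ?thesis using assms(2,4) by (simp add: valid_input_def)
  qed
  have "real (pseudo_BAF A L) \<le> (\<Sum>b\<in>B. 1 + r * total_size (I b))"
    unfolding cost of_nat_sum r_def using assms(3) sz
    by (intro sum_mono length_next_fit_le_small) auto
  also have "\<dots> = real (card B) + r * (\<Sum>b\<in>B. total_size (I b))"
    by (simp add: sum.distrib sum_distrib_left)
  also have "\<dots> \<le> real (card B) + r * real (OPT L)"
    using S assms(3) by (intro add_left_mono mult_left_mono) (auto simp: r_def)
  \<comment> \<open>The remaining \<open>1 / 2\<close> comes from the number of pseudo bins. It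
    disappears in the conclusion because the cost is an integer and the right side is rounded
    up.\<close>
  also have "\<dots> \<le> (1.5 + r) * real (OPT L) + 1 / 2"
    using T by (simp add: algebra_simps)
  finally show ?thesis unfolding r_def by linarith
qed


section \<open>Lists of items annotated with bins\<close>

text \<open>Items carry their offline bin, so that an instance and its packing can be extended
  together by appending, without shifting positions.\<close>

definition bin_of :: "('c item \<times> nat) list \<Rightarrow> nat \<Rightarrow> 'c item list" where
  "bin_of zs b = map fst (filter (\<lambda>z. snd z = b) zs)"

definition packs :: "('c item \<times> nat) list \<Rightarrow> nat \<Rightarrow> bool" where
  "packs zs m \<longleftrightarrow> (\<forall>z\<in>set zs. snd z < m) \<and>
     (\<forall>b. total_size (bin_of zs b) \<le> 1 \<and> successively (\<lambda>x y. fst x \<noteq> fst y) (bin_of zs b))"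

lemma bin_of_append [simp]: "bin_of (zs @ zs') b = bin_of zs b @ bin_of zs' b"
  by (simp add: bin_of_def)

lemma bin_of_spread: "bin_of (map (\<lambda>i. (g i, i)) [0..<n]) b = (if b < n then [g b] else [])"
  by (induction n) (auto simp: bin_of_def less_Suc_eq)

lemma bin_of_const: "bin_of (map (\<lambda>i. (g i, m)) xs) b = (if b = m then map g xs else [])"
  by (induction xs) (auto simp: bin_of_def)

lemma bin_of_unused: "(\<And>z. z \<in> set zs \<Longrightarrow> snd z \<noteq> b) \<Longrightarrow> bin_of zs b = []"
  by (auto simp: bin_of_def filter_empty_conv)

lemma bin_items_annotated:
  "bin_items (\<lambda>i. snd (zs ! i)) (map fst zs) b = bin_of zs b"
proof (induction zs rule: rev_induct)
  case (snoc z zs)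
  have "bin_items (\<lambda>i. snd ((zs @ [z]) ! i)) (map fst zs) b
      = bin_items (\<lambda>i. snd (zs ! i)) (map fst zs) b"
    by (rule bin_items_cong) (simp add: nth_append)
  thus ?case
    using snoc bin_items_snoc[of "\<lambda>i. snd ((zs @ [z]) ! i)" "map fst zs" "fst z" b]
    by (simp add: bin_of_def)
qed (simp add: bin_of_def)

lemma OPT_le_packs:
  assumes "packs zs m"
  shows "OPT (map fst zs) \<le> m"
proof -
  let ?p = "\<lambda>i. snd (zs ! i)"
  have "valid_packing (map fst zs) ?p"
    using assms by (simp add: valid_packing_def packs_def bin_items_annotated)
  hence "OPT (map fst zs) \<le> card (used_bins ?p (map fst zs))"
    by (rule OPT_le)
  also have "\<dots> \<le> card {..<m}"
    using assms by (intro card_mono) (auto simp: packs_def used_bins_def)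
  finally show ?thesis by simp
qed

section \<open>Zero-size rounds in the offline packing\<close>

definition alternating :: "'c \<Rightarrow> 'c \<Rightarrow> nat \<Rightarrow> 'c item list" where
  "alternating x y n = map (\<lambda>i. (if even i then x else y, 0)) [0..<n]"

lemma successively_alternating:
  "x \<noteq> y \<Longrightarrow> successively (\<lambda>u v. fst u \<noteq> fst v) (alternating x y n)"
  by (auto simp: alternating_def successively_conv_nth)

lemma total_size_zero: "(\<And>x. x \<in> set xs \<Longrightarrow> snd x = 0) \<Longrightarrow> total_size xs = 0"
  by (induction xs) auto

lemma total_size_alternating [simp]: "total_size (alternating x y n) = 0"
  by (rule total_size_zero) (auto simp: alternating_def)

text \<open>If the next colour \<open>c'\<close> is again \<open>c\<close>, the alternating items serve as separators, one for each
  bin; otherwise they are not needed for that purpose and all go into one additional bin.\<close>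

lemma packs_round:
  fixes c c' x y :: 'c
  assumes packs: "packs zs m" and "n \<le> m"
    and tops: "\<forall>b<n. bin_of zs b = [] \<or> fst (last (bin_of zs b)) = c"
    and xy: "x \<noteq> c" "y \<noteq> c" "x \<noteq> y"
  obtains zs' where "map fst zs' = map fst zs @ alternating x y n @ replicate n (c', 0)"
    and "packs zs' (Suc m)"
    and "\<forall>b<n. bin_of zs' b = [] \<or> fst (last (bin_of zs' b)) = c'"
proof -
  define g where "g = (\<lambda>i::nat. (if even i then x else y, 0::real))"
  define Z where "Z = map (\<lambda>i. ((c', 0::real), i)) [0..<n]"
  have Z: "bin_of Z b = (if b < n then [(c', 0)] else [])" "map fst Z = replicate n (c', 0)" for b
    by (simp_all add: Z_def bin_of_spread comp_def map_replicate_const)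
  have zs: "\<And>z. z \<in> set zs \<Longrightarrow> snd z < m" "total_size (bin_of zs b) \<le> 1"
    "successively (\<lambda>x y. fst x \<noteq> fst y) (bin_of zs b)" for b
    using packs by (auto simp: packs_def)
  show ?thesis
  proof (cases "c' = c")
    case True
    define Y where "Y = map (\<lambda>i. (g i, i)) [0..<n]"
    have b: "bin_of (zs @ Y @ Z) b = bin_of zs b @ (if b < n then [g b, (c', 0)] else [])" for b
      by (simp add: Z Y_def bin_of_spread)
    have g: "fst (g b) \<noteq> c" "snd (g b) = 0" for b using xy by (simp_all add: g_def)
    show ?thesis
    proof (rule that)
      show "map fst (zs @ Y @ Z) = map fst zs @ alternating x y n @ replicate n (c', 0)"
        by (simp add: Z(2)) (simp add: Y_def g_def alternating_def comp_def)
      show "packs (zs @ Y @ Z) (Suc m)"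
        unfolding packs_def
      proof (intro conjI ballI allI)
        show "snd z < Suc m" if "z \<in> set (zs @ Y @ Z)" for z
          using that zs(1)[of z] \<open>n \<le> m\<close> by (auto simp: Y_def Z_def)
        show "total_size (bin_of (zs @ Y @ Z) b) \<le> 1" for b
          unfolding b using zs(2)[of b] by (simp add: g)
        show "successively (\<lambda>x y. fst x \<noteq> fst y) (bin_of (zs @ Y @ Z) b)" for b
        proof (cases "b < n")
          case True
          thus ?thesis
            using zs(3)[of b] tops[rule_format, of b] g(1)[of b] \<open>c' = c\<close>
            unfolding b by (auto simp: successively_append_iff)
        next
          case False
          thus ?thesis using zs(3)[of b] unfolding b by simp
        qed
      qed
      show "\<forall>b<n. bin_of (zs @ Y @ Z) b = [] \<or> fst (last (bin_of (zs @ Y @ Z) b)) = c'"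
        unfolding b by simp
    qed
  next
    case False
    define Y where "Y = map (\<lambda>i. (g i, m)) [0..<n]"
    have alt: "map g [0..<n] = alternating x y n"
      by (simp add: g_def alternating_def)
    have m: "bin_of zs m = []"
      by (rule bin_of_unused) (use zs(1) in force)
    have b: "bin_of (zs @ Y @ Z) b = (if b = m then alternating x y n
        else bin_of zs b @ (if b < n then [(c', 0)] else []))" for b
      using m \<open>n \<le> m\<close> by (simp add: Z Y_def bin_of_const alt)
    show ?thesis
    proof (rule that)
      show "map fst (zs @ Y @ Z) = map fst zs @ alternating x y n @ replicate n (c', 0)"
        by (simp add: Z(2)) (simp add: Y_def alt comp_def)
      show "packs (zs @ Y @ Z) (Suc m)"
        unfolding packs_def
      proof (intro conjI ballI allI)
        show "snd z < Suc m" if "z \<in> set (zs @ Y @ Z)" for z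
          using that zs(1)[of z] \<open>n \<le> m\<close> by (auto simp: Y_def Z_def)
        show "total_size (bin_of (zs @ Y @ Z) b) \<le> 1" for b
          unfolding b using zs(2)[of b] by simp
        show "successively (\<lambda>x y. fst x \<noteq> fst y) (bin_of (zs @ Y @ Z) b)" for b
        proof (cases "b = m")
          case True
          thus ?thesis unfolding b using xy by (simp add: successively_alternating)
        next
          case nm: False
          show ?thesis
            using zs(3)[of b] tops[rule_format, of b] False nm
            unfolding b by (auto simp: successively_append_iff)
        qed
      qed
      show "\<forall>b<n. bin_of (zs @ Y @ Z) b = [] \<or> fst (last (bin_of (zs @ Y @ Z) b)) = c'"
        unfolding b using \<open>n \<le> m\<close> by simp
    qed
  qed
qed

text \<open>Each size belongs to an item of colour \<open>b\<close>, followed by a separator of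
  colour \<open>c\<close> and size zero in the same bin. The colours thus alternate in the input as
  well as in every offline bin, whatever bins are chosen.\<close>

definition pairs :: "'c \<Rightarrow> 'c \<Rightarrow> (real \<times> nat) list \<Rightarrow> ('c item \<times> nat) list" where
  "pairs b c ss = concat (map (\<lambda>(s, \<beta>). [((b, s), \<beta>), ((c, 0), \<beta>)]) ss)"

definition interleaved :: "'c \<Rightarrow> 'c \<Rightarrow> real list \<Rightarrow> 'c item list" where
  "interleaved b c ss = concat (map (\<lambda>s. [(b, s), (c, 0)]) ss)"

lemma bin_of_pairs: "bin_of (pairs b c ss) \<beta> = interleaved b c (map fst (filter (\<lambda>z. snd z = \<beta>) ss))"
  by (induction ss) (auto simp: bin_of_def pairs_def interleaved_def)

lemma map_fst_pairs: "map fst (pairs b c ss) = interleaved b c (map fst ss)"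
  by (induction ss) (auto simp: pairs_def interleaved_def)

lemma interleaved_Nil [simp]: "interleaved b c [] = []"
  by (simp add: interleaved_def)

lemma interleaved_Cons [simp]: "interleaved b c (s # ss) = (b, s) # (c, 0) # interleaved b c ss"
  by (simp add: interleaved_def)

lemma interleaved_append: "interleaved b c (ss @ ss') = interleaved b c ss @ interleaved b c ss'"
  by (simp add: interleaved_def)

lemma interleaved_concat: "interleaved b c (concat sss) = concat (map (interleaved b c) sss)"
  by (induction sss) (auto simp: interleaved_append)

lemma total_size_interleaved [simp]: "total_size (interleaved b c ss) = sum_list ss"
  by (induction ss) auto

lemma hd_interleaved: "ss \<noteq> [] \<Longrightarrow> hd (interleaved b c ss) = (b, hd ss)"
  by (cases ss) auto

lemma interleaved_eq_Nil_iff [simp]: "interleaved b c ss = [] \<longleftrightarrow> ss = []"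
  by (cases ss) auto

lemma successively_interleaved:
  "b \<noteq> c \<Longrightarrow> successively (\<lambda>x y. fst x \<noteq> fst y) (interleaved b c ss)"
proof (induction ss)
  case (Cons s ss)
  thus ?case by (auto simp: successively_Cons hd_interleaved)
qed simp

lemma last_interleaved: "ss \<noteq> [] \<Longrightarrow> last (interleaved b c ss) = (c, 0)"
  by (induction ss) auto

lemma set_interleaved: "set (interleaved b c ss) \<subseteq> Pair b ` set ss \<union> {(c, 0)}"
  by (induction ss) auto

text \<open>Because pairs stay together, only the capacity has to be checked. The second claim
  provides the common top colour with which the adversary's rounds start.\<close>

lemma packs_pairs:
  assumes "b \<noteq> c" "\<And>z. z \<in> set ss \<Longrightarrow> snd z < m"
    and "\<And>\<beta>. sum_list (map fst (filter (\<lambda>z. snd z = \<beta>) ss)) \<le> 1"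
  shows "packs (pairs b c ss) m"
    and "bin_of (pairs b c ss) \<beta> = [] \<or> fst (last (bin_of (pairs b c ss) \<beta>)) = c"
proof -
  have "snd z < m" if "z \<in> set (pairs b c ss)" for z
    using that assms(2) by (fastforce simp: pairs_def)
  thus "packs (pairs b c ss) m"
    using assms by (simp add: packs_def bin_of_pairs successively_interleaved)
  show "bin_of (pairs b c ss) \<beta> = [] \<or> fst (last (bin_of (pairs b c ss) \<beta>)) = c"
    unfolding bin_of_pairs
    by (cases "map fst (filter (\<lambda>z. snd z = \<beta>) ss) = []") (simp_all add: last_interleaved del: map_is_Nil_conv)
qed


section \<open>Forcing many pseudo bins\<close>

lemma baf_num_replicate:
  fixes A :: "'c::finite list \<Rightarrow> 'c \<Rightarrow> nat"
  assumes "is_BAF A"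
  shows "baf_num A (cs @ replicate n c) c = baf_num A cs c + int n"
proof (induction n)
  case (Suc n)
  have "cs @ replicate (Suc n) c = (cs @ replicate n c) @ [c]"
    by (simp add: replicate_append_same)
  hence "baf_num A (cs @ replicate (Suc n) c) c = baf_num A (cs @ replicate n c) c + 1"
    using baf_choice_not_top[OF assms, of "cs @ replicate n c" c]
    by (simp only: baf_num_eq baf_tops_snoc) simp
  thus ?case using Suc by simp
qed simp

text \<open>Pigeonhole principle: every bin has one of the three colours on top.\<close>

lemma frequent_top_color:
  assumes "set cs \<subseteq> {x, y, z}"
  obtains c where "c \<in> {x, y, z}" "int (card (baf_bins A cs)) \<le> 3 * baf_num A cs c"
proof -
  have "baf_bins A cs \<subseteq> baf_tops A cs x \<union> (baf_tops A cs y \<union> baf_tops A cs z)"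
  proof
    fix b assume b: "b \<in> baf_bins A cs"
    hence "bin_items (assignment A cs) cs b \<noteq> []"
      by (simp add: bin_items_eq_Nil_iff baf_bins_def)
    hence "last (bin_items (assignment A cs) cs b) \<in> set cs"
      by (rule subsetD[OF set_bin_items_subset last_in_set])
    thus "b \<in> baf_tops A cs x \<union> (baf_tops A cs y \<union> baf_tops A cs z)"
      using assms b by (auto simp: baf_tops_def baf_bins_def c_bins_def)
  qed
  hence "card (baf_bins A cs) \<le> card (baf_tops A cs x \<union> (baf_tops A cs y \<union> baf_tops A cs z))"
    by (intro card_mono) simp
  also have "\<dots> \<le> card (baf_tops A cs x) + (card (baf_tops A cs y) + card (baf_tops A cs z))"
    using card_Un_le[of "baf_tops A cs x" "baf_tops A cs y \<union> baf_tops A cs z"]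
      card_Un_le[of "baf_tops A cs y" "baf_tops A cs z"] by linarith
  finally have "int (card (baf_bins A cs)) \<le> baf_num A cs x + baf_num A cs y + baf_num A cs z"
    by (simp add: baf_num_eq)
  hence "int (card (baf_bins A cs)) \<le> 3 * baf_num A cs x \<or>
      int (card (baf_bins A cs)) \<le> 3 * baf_num A cs y \<or>
      int (card (baf_bins A cs)) \<le> 3 * baf_num A cs z"
    by linarith
  thus ?thesis using that by blast
qed

text \<open>In each round the adversary repeats a colour that is on top of at least a third of the bins.
  All these items raise the number of bins of that colour, so the number \<open>T\<close> of bins becomes at
  least \<open>T/3 + n\<close>, a recursion with fixed point \<open>3n/2\<close>.\<close>

lemma many_bins_rounds:
  fixes A :: "'c::finite list \<Rightarrow> 'c \<Rightarrow> nat"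
  assumes A: "is_BAF A" and xyz: "x \<noteq> y" "x \<noteq> z" "y \<noteq> z"
    and packs: "packs zs n" and c: "c \<in> {x, y, z}"
    and tops: "\<forall>b<n. bin_of zs b = [] \<or> fst (last (bin_of zs b)) = c"
    and colors: "fst ` set (map fst zs) \<subseteq> {x, y, z}"
  shows "\<exists>zs' ws c'. map fst zs' = map fst zs @ ws \<and> set ws \<subseteq> {x, y, z} \<times> {0} \<and>
    packs zs' (n + k) \<and> c' \<in> {x, y, z} \<and>
    (\<forall>b<n. bin_of zs' b = [] \<or> fst (last (bin_of zs' b)) = c') \<and>
    1.5 * real n * (1 - (1 / 3) ^ k) \<le> real (card (baf_bins A (map fst (map fst zs'))))"
proof (induction k)
  case 0
  show ?case
    using packs c tops by (intro exI[of _ zs] exI[of _ "[]"] exI[of _ c]) simp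
next
  case (Suc k)
  then obtain zs' ws c' where IH: "map fst zs' = map fst zs @ ws" "set ws \<subseteq> {x, y, z} \<times> {0}"
    "packs zs' (n + k)" "c' \<in> {x, y, z}"
    "\<forall>b<n. bin_of zs' b = [] \<or> fst (last (bin_of zs' b)) = c'"
    "1.5 * real n * (1 - (1 / 3) ^ k) \<le> real (card (baf_bins A (map fst (map fst zs'))))"
    by blast
  obtain u v where uv: "u \<noteq> c'" "v \<noteq> c'" "u \<noteq> v" "u \<in> {x, y, z}" "v \<in> {x, y, z}"
  proof -
    consider "c' = x" | "c' = y" | "c' = z" using IH(4) by blast
    thus ?thesis
      by cases (use xyz that[of y z] that[of x z] that[of x y] in auto)
  qed
  define ds where "ds = map fst (map fst zs')"
  define es where "es = ds @ map fst (alternating u v n)"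
  have alt: "set (alternating u v n) \<subseteq> {x, y, z} \<times> {0}"
  proof -
    have "set (alternating u v n) \<subseteq> {u, v} \<times> {0}"
      by (auto simp: alternating_def)
    thus ?thesis using uv(4,5) by blast
  qed
  have "set ds \<subseteq> {x, y, z}"
    using colors IH(2) by (auto simp: ds_def IH(1) simp del: map_map)
  hence es: "set es \<subseteq> {x, y, z}"
    using alt by (auto simp: es_def)
  \<comment> \<open>The colour is chosen only after the alternating items, since these may change
    the tops of the pseudo bins. The round costs the offline packing at most one additional
    bin.\<close>
  obtain e where e: "e \<in> {x, y, z}" "int (card (baf_bins A es)) \<le> 3 * baf_num A es e"
    using frequent_top_color[OF es, where A = A] .
  obtain zs'' where zs'': "map fst zs'' = map fst zs' @ alternating u v n @ replicate n (e, 0)"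
    "packs zs'' (Suc (n + k))"
    "\<forall>b<n. bin_of zs'' b = [] \<or> fst (last (bin_of zs'' b)) = e"
    using packs_round[OF IH(3) le_add1 IH(5) uv(1-3), of e] .
  have colors'': "map fst (map fst zs'') = es @ replicate n e"
    unfolding zs''(1) es_def ds_def by simp
  have "card (baf_bins A ds) \<le> card (baf_bins A es)"
    unfolding es_def by (intro card_mono baf_bins_append_mono) simp
  hence "real (card (baf_bins A ds)) \<le> 3 * real (card (baf_tops A es e))"
    using e(2) unfolding baf_num_eq by linarith
  moreover have "card (baf_tops A es e) + n \<le> card (baf_bins A (es @ replicate n e))"
    using baf_num_replicate[OF A, of es n e] card_mono[OF _ baf_tops_subset, of A "es @ replicate n e" e]
    by (simp add: baf_num_eq)
  ultimately have "real (card (baf_bins A ds)) / 3 + real n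
      \<le> real (card (baf_bins A (es @ replicate n e)))"
    by linarith
  moreover have "1.5 * real n * (1 - (1 / 3) ^ Suc k)
      = 1.5 * real n * (1 - (1 / 3) ^ k) / 3 + real n"
    by (simp add: field_simps)
  ultimately have "1.5 * real n * (1 - (1 / 3) ^ Suc k)
      \<le> real (card (baf_bins A (map fst (map fst zs''))))"
    unfolding colors'' using IH(6) unfolding ds_def by linarith
  moreover have "map fst zs'' = map fst zs @ (ws @ alternating u v n @ replicate n (e, 0))"
    by (simp add: zs''(1) IH(1))
  moreover have "set (ws @ alternating u v n @ replicate n (e, 0)) \<subseteq> {x, y, z} \<times> {0}"
    using IH(2) alt e(1) by auto
  ultimately show ?case
    using zs''(2,3) e(1)
    by (intro exI[of _ zs''] exI[of _ "ws @ alternating u v n @ replicate n (e, 0)"] exI[of _ e])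
      simp
qed


section \<open>Wasting space in one pseudo bin\<close>

text \<open>The top of the only bin is the preceding item, whose colour differs from the new one, so
  no second bin is opened.\<close>

lemma baf_bins_alternating:
  fixes A :: "'c::finite list \<Rightarrow> 'c \<Rightarrow> nat"
  assumes A: "is_BAF A" and "cs \<noteq> []" "successively (\<noteq>) cs"
  shows "baf_bins A cs = {A [] (hd cs)}"
  using assms(2,3)
proof (induction cs rule: rev_nonempty_induct)
  case (single c)
  show ?case using baf_bins_snoc[of A "[]" c] by simp
next
  case (snoc c cs)
  let ?X = "A [] (hd cs)"
  have bins: "baf_bins A cs = {?X}" and last: "last cs \<noteq> c"
    using snoc by (auto simp: successively_append_iff)
  have "bin_items (assignment A cs) cs ?X = cs"
    using bins by (intro bin_items_single) (simp add: baf_bins_def)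
  hence "?X \<notin> baf_tops A cs c"
    using last by (simp add: baf_tops_def c_bins_def)
  hence "A cs c \<in> baf_bins A cs"
    using bins by (intro baf_choice_used[OF A]) auto
  thus ?case using bins snoc by (simp add: baf_bins_snoc)
qed

text \<open>All of \<open>L\<close> lies in one pseudo bin, where it is followed by the items
  \<open>rest\<close> of \<open>M\<close> that are sent there. Every other pseudo bin costs at least
  one real bin; the \<open>+ 1\<close> compensates for counting the first pseudo bin in both
  summands.\<close>

lemma pseudo_BAF_ge:
  fixes A :: "'c::finite list \<Rightarrow> 'c \<Rightarrow> nat"
  assumes A: "is_BAF A" and "L \<noteq> []" and alt: "successively (\<lambda>x y. fst x \<noteq> fst y) L"
  obtains rest where
    "length (next_fit (L @ rest)) + card (baf_bins A (map fst (L @ M))) \<le> pseudo_BAF A (L @ M) + 1"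
proof -
  define cs where "cs = map fst L"
  define ds where "ds = map fst M"
  define X where "X = A [] (hd cs)"
  define p where "p = assignment A (cs @ ds)"
  have X: "baf_bins A cs = {X}"
    unfolding X_def using assms(2) alt
    by (intro baf_bins_alternating[OF A]) (auto simp: cs_def successively_map)
  hence X_in: "X \<in> baf_bins A (cs @ ds)"
    using baf_bins_append_mono[of A cs ds] by auto
  have "bin_items p L X = bin_items (assignment A cs) L X"
    unfolding p_def by (rule bin_items_cong) (simp add: assignment_append cs_def)
  also have "\<dots> = L"
    using X by (intro bin_items_single) (simp add: baf_bins_def cs_def)
  finally obtain rest where rest: "bin_items p (L @ M) X = L @ rest"
    by (simp add: bin_items_append)
  have pos: "1 \<le> length (next_fit (bin_items p (L @ M) b))" if "b \<in> baf_bins A (cs @ ds)" for b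
  proof -
    have "bin_items p (L @ M) b \<noteq> []"
      using that unfolding bin_items_eq_Nil_iff p_def baf_bins_def
      by (simp add: cs_def ds_def used_bins_def)
    thus ?thesis using length_next_fit_aux_pos by (cases "bin_items p (L @ M) b") auto
  qed
  have "pseudo_BAF A (L @ M)
      = (\<Sum>b\<in>baf_bins A (cs @ ds). length (next_fit (bin_items p (L @ M) b)))"
    by (simp add: pseudo_BAF_eq p_def cs_def ds_def)
  also have "\<dots> = length (next_fit (L @ rest))
      + (\<Sum>b\<in>baf_bins A (cs @ ds) - {X}. length (next_fit (bin_items p (L @ M) b)))"
    using X_in by (subst sum.remove[of _ X]) (auto simp: rest)
  also have "\<dots> \<ge> length (next_fit (L @ rest)) + (\<Sum>b\<in>baf_bins A (cs @ ds) - {X}. 1)"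
    using pos by (intro add_left_mono sum_mono) auto
  finally have "length (next_fit (L @ rest)) + (card (baf_bins A (cs @ ds)) - 1)
      \<le> pseudo_BAF A (L @ M)"
    using X_in by simp
  thus ?thesis using that[of rest] by (simp add: cs_def ds_def)
qed

text \<open>Here \<open>m\<close> is the number of bins closed while \<open>ys\<close> is packed,
  and \<open>B'\<close> is the current bin afterwards.\<close>

lemma next_fit_aux_append_cases:
  assumes "\<And>y. y \<in> set ys \<Longrightarrow> 0 \<le> snd y" "0 \<le> total_size B"
  obtains m B' where "length (next_fit_aux B (ys @ rest)) = m + length (next_fit_aux B' rest)"
    and "m = 0 \<Longrightarrow> B' = B @ ys" and "0 \<le> total_size B'"
proof -
  have "\<exists>m B'. length (next_fit_aux B (ys @ rest)) = m + length (next_fit_aux B' rest) \<and>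
      (m = 0 \<longrightarrow> B' = B @ ys) \<and> 0 \<le> total_size B'"
    using assms
  proof (induction ys arbitrary: B)
    case Nil
    thus ?case by (intro exI[of _ 0] exI[of _ B]) simp
  next
    case (Cons y ys)
    have y: "0 \<le> snd y" using Cons.prems(1) by simp
    show ?case
    proof (cases "total_size B + snd y \<le> 1")
      case True
      have "\<exists>m B'. length (next_fit_aux (B @ [y]) (ys @ rest)) = m + length (next_fit_aux B' rest) \<and>
          (m = 0 \<longrightarrow> B' = (B @ [y]) @ ys) \<and> 0 \<le> total_size B'"
        using Cons.prems y by (intro Cons.IH) auto
      thus ?thesis using True by simp
    next
      case False
      have "\<exists>m B'. length (next_fit_aux [y] (ys @ rest)) = m + length (next_fit_aux B' rest) \<and>
          (m = 0 \<longrightarrow> B' = [y] @ ys) \<and> 0 \<le> total_size B'"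
        using Cons.prems y by (intro Cons.IH) auto
      then obtain m B' where "length (next_fit_aux [y] (ys @ rest)) = m + length (next_fit_aux B' rest)"
        "0 \<le> total_size B'" by blast
      thus ?thesis using False by (intro exI[of _ "Suc m"] exI[of _ B']) simp
    qed
  qed
  thus ?thesis using that by blast
qed

text \<open>A block starts with an item of size \<open>s\<close> and has total size above \<open>1 - s\<close>, so Next Fit opens a
  new bin at the latest when the next block begins.\<close>

lemma next_fit_aux_blocks:
  assumes "\<And>bl. bl \<in> set bs \<Longrightarrow> \<exists>x ys. bl = x # ys \<and> snd x = s \<and> 1 - 2 * s < total_size ys \<and>
      (\<forall>y\<in>set ys. 0 \<le> snd y)"
    and "0 \<le> s" "0 \<le> total_size B"
  shows "length bs + (if 1 - s < total_size B then 1 else 0)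
    \<le> length (next_fit_aux B (concat bs @ rest))"
  using assms(1,3)
proof (induction bs arbitrary: B)
  case Nil
  show ?case using length_next_fit_aux_pos[of B rest] by simp
next
  case (Cons bl bs)
  obtain x ys where bl: "bl = x # ys" "snd x = s" "1 - 2 * s < total_size ys"
    and ys: "\<And>y. y \<in> set ys \<Longrightarrow> 0 \<le> snd y"
    using Cons.prems(1)[of bl] by (metis list.set_intros(1))
  \<comment> \<open>\<open>B'\<close> is the bin that has just received the first item of the block.
    If the rest of the block closes no bin, the content exceeds \<open>1 - s\<close> and the
    induction hypothesis yields the additional bin; otherwise a closed bin accounts for it.\<close>
  have step: "length bs + 1 \<le> length (next_fit_aux B' (ys @ concat bs @ rest))"
    if B': "s \<le> total_size B'" for B'
  proof -
    have "0 \<le> total_size B'" using B' \<open>0 \<le> s\<close> by simp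
    then obtain m B'' where m: "length (next_fit_aux B' (ys @ concat bs @ rest))
        = m + length (next_fit_aux B'' (concat bs @ rest))"
      "m = 0 \<Longrightarrow> B'' = B' @ ys" "0 \<le> total_size B''"
      using next_fit_aux_append_cases[OF ys] by metis
    have IH: "length bs + (if 1 - s < total_size B'' then 1 else 0)
        \<le> length (next_fit_aux B'' (concat bs @ rest))"
      using Cons.prems(1) m(3) by (intro Cons.IH) auto
    show ?thesis
    proof (cases "m = 0")
      case True
      hence "1 - s < total_size B''" using m(2) bl(3) B' by simp
      thus ?thesis using m(1) IH by simp
    next
      case False
      thus ?thesis using m(1) IH by (simp split: if_splits)
    qed
  qed
  show ?case
  \<comment> \<open>The case distinction matches the extra summand: if the first item of the block
    does not fit, \<open>B\<close> is closed and pays for that summand.\<close>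
  proof (cases "total_size B + s \<le> 1")
    case True
    thus ?thesis using step[of "B @ [x]"] bl(1,2) Cons.prems(2) by simp
  next
    case False
    thus ?thesis using step[of "[x]"] bl(1,2) by simp
  qed
qed

lemma next_fit_blocks:
  assumes "\<And>bl. bl \<in> set bs \<Longrightarrow> \<exists>x ys. bl = x # ys \<and> snd x = s \<and> 1 - 2 * s < total_size ys \<and>
      (\<forall>y\<in>set ys. 0 \<le> snd y)"
    and "0 \<le> s" "s \<le> 1" "bs \<noteq> []"
  shows "length bs \<le> length (next_fit (concat bs @ rest))"
proof -
  obtain bl bs' where bs: "bs = bl # bs'" using assms(4) by (cases bs) auto
  obtain x ys where bl: "bl = x # ys" "snd x = s"
    using assms(1)[of bl] bs by auto
  \<comment> \<open>An empty current bin agrees with \<open>next_fit\<close>, since the first item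
    has size \<open>s \<le> 1\<close>.\<close>
  have "length bs \<le> length (next_fit_aux [] (concat bs @ rest))"
    using next_fit_aux_blocks[of bs s "[]" rest] assms(1,2) by simp
  thus ?thesis using assms(3) by (simp add: bs bl)
qed


section \<open>The hard instances\<close>

text \<open>Block sizes with the bins of an offline packing: a pair of blocks has two items of size \<open>1/d\<close>
  and \<open>q + 1\<close> grains of size \<open>1/j\<close> after each of them. The two large items and \<open>q\<close> grains of the
  \<open>k\<close>-th pair share bin \<open>k\<close>; each of the other \<open>q + 2\<close> grains goes into one of the bins
  \<open>j, \<dots>, j + q + 1\<close>, which thus receive one grain from each pair.\<close>

definition block1 :: "real \<Rightarrow> nat \<Rightarrow> nat \<Rightarrow> nat \<Rightarrow> (real \<times> nat) list" where
  "block1 d j q k = (1 / d, k) # replicate q (1 / real j, k) @ [(1 / real j, j)]"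

definition block2 :: "real \<Rightarrow> nat \<Rightarrow> nat \<Rightarrow> nat \<Rightarrow> (real \<times> nat) list" where
  "block2 d j q k = (1 / d, k) # map (\<lambda>t. (1 / real j, j + 1 + t)) [0..<Suc q]"

definition blocks :: "real \<Rightarrow> nat \<Rightarrow> nat \<Rightarrow> (real \<times> nat) list list" where
  "blocks d j q = concat (map (\<lambda>k. [block1 d j q k, block2 d j q k]) [0..<j])"

lemma length_blocks: "length (blocks d j q) = 2 * j"
  by (simp add: blocks_def length_concat comp_def sum_list_triv)

lemma set_blocks: "set (blocks d j q) = (\<Union>k<j. {block1 d j q k, block2 d j q k})"
  by (auto simp: blocks_def)

lemma block_cases:
  assumes "bl \<in> set (blocks d j q)"
  obtains k ys where "k < j" "bl = (1 / d, k) # ys" "map fst ys = replicate (Suc q) (1 / real j)"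
    "\<forall>z\<in>set ys. snd z < j + q + 2"
proof -
  obtain k where k: "k < j" "bl = block1 d j q k \<or> bl = block2 d j q k"
    using assms by (auto simp: set_blocks)
  from k(2) show ?thesis
  proof
    assume "bl = block1 d j q k"
    thus ?thesis
      using k(1) by (intro that[of k "replicate q (1 / real j, k) @ [(1 / real j, j)]"])
        (auto simp: block1_def replicate_append_same)
  next
    assume "bl = block2 d j q k"
    thus ?thesis
      using k(1) by (intro that[of k "map (\<lambda>t. (1 / real j, j + 1 + t)) [0..<Suc q]"])
        (auto simp: block2_def comp_def map_replicate_const simp del: upt_Suc replicate_Suc)
  qed
qed

section \<open>Loads of the offline bins\<close>

definition load :: "nat \<Rightarrow> (real \<times> nat) list \<Rightarrow> real" where
  "load \<beta> ss = sum_list (map fst (filter (\<lambda>z. snd z = \<beta>) ss))"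

lemma load_append: "load \<beta> (ss @ ss') = load \<beta> ss + load \<beta> ss'"
  by (simp add: load_def)

lemma load_concat: "load \<beta> (concat sss) = sum_list (map (load \<beta>) sss)"
  by (induction sss) (auto simp: load_append load_def)

lemma load_replicate: "load \<beta> (replicate q (s, k)) = (if \<beta> = k then real q * s else 0)"
  by (induction q) (auto simp: load_def algebra_simps)

lemma load_grains: "load \<beta> (map (\<lambda>t. (s, m + t)) [0..<q]) = (if m \<le> \<beta> \<and> \<beta> < m + q then s else 0)"
  by (induction q) (auto simp: load_def)

text \<open>The bins of the single grains start at \<open>j\<close>, beyond bin \<open>k\<close>.
  Their upper end \<open>j + q + 1\<close> is dropped, as only an upper bound on the load is
  wanted.\<close>

lemma load_pair_of_blocks:
  assumes "k < j"
  shows "load \<beta> (block1 d j q k) + load \<beta> (block2 d j q k)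
    \<le> (if \<beta> = k then 2 / d + real q / real j else 0) + (if j \<le> \<beta> then 1 / real j else 0)"
proof -
  have "load \<beta> (block1 d j q k)
      = load \<beta> [(1 / d, k)] + load \<beta> (replicate q (1 / real j, k)) + load \<beta> [(1 / real j, j)]"
    unfolding block1_def by (simp flip: load_append)
  moreover have "load \<beta> (block2 d j q k)
      = load \<beta> [(1 / d, k)] + load \<beta> (map (\<lambda>t. (1 / real j, (j + 1) + t)) [0..<Suc q])"
    unfolding block2_def by (simp flip: load_append del: upt_Suc)
  ultimately show ?thesis
    using assms unfolding load_grains load_replicate by (auto simp: load_def)
qed

lemma sum_list_pairs:
  fixes f :: "'a \<Rightarrow> 'b::comm_monoid_add"
  shows "sum_list (map f (concat (map (\<lambda>k. [a k, b k]) [0..<j]))) = (\<Sum>k<j. f (a k) + f (b k))"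
  by (induction j) (simp_all add: add.assoc)

text \<open>A bin below \<open>j\<close> is loaded only by its own pair of blocks; any other bin
  receives at most one grain of size \<open>1 / j\<close> from each of the \<open>j\<close>
  pairs.\<close>

lemma load_blocks:
  assumes "0 < j" "2 / d + real q / real j \<le> 1"
  shows "load \<beta> (concat (blocks d j q)) \<le> 1"
proof -
  have "load \<beta> (concat (blocks d j q))
      = (\<Sum>k<j. load \<beta> (block1 d j q k) + load \<beta> (block2 d j q k))"
    unfolding load_concat by (simp add: sum_list_pairs blocks_def)
  also have "\<dots> \<le> (\<Sum>k<j. (if \<beta> = k then 2 / d + real q / real j else 0)
      + (if j \<le> \<beta> then 1 / real j else 0))"
    by (intro sum_mono load_pair_of_blocks) simp
  also have "\<dots> = (if \<beta> < j then 2 / d + real q / real j else 0) + (if j \<le> \<beta> then 1 else 0)"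
    using assms(1) by (simp add: sum.distrib)
  also have "\<dots> \<le> 1" using assms by auto
  finally show ?thesis .
qed

text \<open>\<open>q\<close> is the largest number of grains that fit beside two items of size
  \<open>1 / d\<close>. Hence one such item with \<open>q + 1\<close> grains exceeds
  \<open>1 - 1 / d\<close>, and Next Fit spends \<open>2 * j\<close> bins on the blocks, while the
  offline packing needs only \<open>n\<close>. Then \<open>k\<close> rounds of zero-size items
  follow, at the price of at most \<open>k\<close> offline bins.\<close>

lemma hard_instance:
  fixes A :: "'c::finite list \<Rightarrow> 'c \<Rightarrow> nat" and d :: real and x y z :: 'c
  assumes A: "is_BAF A" and xyz: "x \<noteq> y" "x \<noteq> z" "y \<noteq> z"
    and d: "2 \<le> d" "d \<le> real j" and q: "q = nat \<lfloor>(1 - 2 / d) * real j\<rfloor>" and n: "n = j + q + 2"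
  shows "\<exists>L. valid_input L \<and> (\<forall>u\<in>set L. snd u \<le> 1 / d) \<and> OPT L \<le> n + k \<and>
    2 * real j + 1.5 * real n * (1 - (1 / 3) ^ k) \<le> real (pseudo_BAF A L) + 1"
proof -
  have j: "0 < j" using d by (cases j) auto
  have "0 \<le> (1 - 2 / d) * real j" using d by simp
  hence q_bounds: "real q \<le> (1 - 2 / d) * real j" "(1 - 2 / d) * real j < real (Suc q)"
    unfolding q by linarith+
  have cap: "2 / d + real q / real j \<le> 1"
    using q_bounds(1) j by (simp add: field_simps)
  have grains: "1 - 2 / d < real (Suc q) / real j"
    using q_bounds(2) j by (simp add: field_simps)
  define ss where "ss = concat (blocks d j q)"
  define zs where "zs = pairs x y ss"
  have ss_size: "fst u = 1 / d \<or> fst u = 1 / real j" if u: "u \<in> set ss" for u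
  proof -
    obtain bl where "bl \<in> set (blocks d j q)" "u \<in> set bl"
      using u unfolding ss_def set_concat by blast
    then obtain k ys where "u = (1 / d, k) \<or> u \<in> set ys" "map fst ys = replicate (Suc q) (1 / real j)"
      by (elim block_cases) auto
    moreover from this(2) have "fst ` set ys = {1 / real j}"
      by (metis list.set_map set_replicate nat.distinct(1))
    ultimately show ?thesis by auto
  qed
  have ss_bin: "snd u < n" if u: "u \<in> set ss" for u
  proof -
    obtain bl where "bl \<in> set (blocks d j q)" "u \<in> set bl"
      using u unfolding ss_def set_concat by blast
    thus ?thesis by (elim block_cases) (auto simp: n)
  qed
  have load: "sum_list (map fst (filter (\<lambda>z. snd z = \<beta>) ss)) \<le> 1" for \<beta>
    using load_blocks[OF j cap, of \<beta>] by (simp add: load_def ss_def)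
  have zs: "packs zs n" "\<forall>b<n. bin_of zs b = [] \<or> fst (last (bin_of zs b)) = y"
    unfolding zs_def using packs_pairs[of x y ss n] xyz(1) ss_bin load by simp_all
  define L where "L = map fst zs"
  have L: "L = interleaved x y (map fst ss)"
    by (simp add: L_def zs_def map_fst_pairs)
  have L_set: "set L \<subseteq> {x} \<times> {1 / d, 1 / real j} \<union> {(y, 0)}"
    using set_interleaved[of x y "map fst ss"] ss_size unfolding L by fastforce
  have "fst ` set (map fst zs) \<subseteq> {x, y, z}"
    using L_set by (auto simp: L_def)
  moreover have "y \<in> {x, y, z}" by simp
  ultimately obtain zs' ws where zs': "map fst zs' = L @ ws" "set ws \<subseteq> {x, y, z} \<times> {0}" "packs zs' (n + k)"
    "1.5 * real n * (1 - (1 / 3) ^ k) \<le> real (card (baf_bins A (map fst (map fst zs'))))"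
    using many_bins_rounds[OF A xyz zs(1) _ zs(2), of k] unfolding L_def by blast
  have sizes: "0 \<le> snd u \<and> snd u \<le> 1 / d" if "u \<in> set (L @ ws)" for u
  proof -
    have "1 / real j \<le> 1 / d" using d by (simp add: frac_le)
    moreover have "snd u \<in> {0, 1 / d, 1 / real j}"
      using that L_set zs'(2) by auto
    ultimately show ?thesis using d by auto
  qed
  moreover have "1 / d \<le> 1" using d by simp
  ultimately have "valid_input (L @ ws)"
    unfolding valid_input_def using order_trans by blast
  moreover have "OPT (L @ ws) \<le> n + k"
    using OPT_le_packs[OF zs'(3)] by (simp add: zs'(1))
  moreover have "2 * real j + 1.5 * real n * (1 - (1 / 3) ^ k) \<le> real (pseudo_BAF A (L @ ws)) + 1"
  proof -
    have ne: "blocks d j q \<noteq> []" using length_blocks[of d j q] j by auto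
    hence L_ne: "L \<noteq> []"
      using j by (auto simp: L ss_def set_blocks block1_def)
    have alt: "successively (\<lambda>x y. fst x \<noteq> fst y) L"
      unfolding L by (rule successively_interleaved[OF xyz(1)])
    obtain rest where rest: "length (next_fit (L @ rest)) + card (baf_bins A (map fst (L @ ws)))
        \<le> pseudo_BAF A (L @ ws) + 1"
      using pseudo_BAF_ge[OF A L_ne alt] .
    define bs where "bs = map (\<lambda>bl. interleaved x y (map fst bl)) (blocks d j q)"
    have "L = concat bs"
      by (simp add: L ss_def bs_def map_concat interleaved_concat comp_def)
    moreover have "length bs \<le> length (next_fit (concat bs @ rest))"
    proof (rule next_fit_blocks)
      fix bl assume "bl \<in> set bs"
      then obtain bl' where bl': "bl' \<in> set (blocks d j q)" "bl = interleaved x y (map fst bl')"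
        by (auto simp: bs_def)
      from bl'(1) obtain k ys where ys: "bl' = (1 / d, k) # ys"
        "map fst ys = replicate (Suc q) (1 / real j)"
        by (elim block_cases) auto
      have "1 - 2 * (1 / d) < total_size ((y, 0) # interleaved x y (map fst ys))"
        using grains by (simp add: ys(2) sum_list_replicate add_divide_distrib)
      moreover have "\<forall>u\<in>set ((y, 0) # interleaved x y (map fst ys)). 0 \<le> snd u"
        using set_interleaved[of x y "map fst ys"] by (force simp: ys(2))
      ultimately show "\<exists>u us. bl = u # us \<and> snd u = 1 / d \<and> 1 - 2 * (1 / d) < total_size us \<and>
          (\<forall>v\<in>set us. 0 \<le> snd v)"
        unfolding bl'(2) ys(1)
        by (intro exI[of _ "(x, 1 / d)"] exI[of _ "(y, 0) # interleaved x y (map fst ys)"]) simp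
    qed (use d ne in \<open>auto simp: bs_def\<close>)
    moreover have "length bs = 2 * j" by (simp add: bs_def length_blocks)
    ultimately show ?thesis
      using rest zs'(1,4) by simp
  qed
  ultimately show ?thesis using sizes by blast
qed

text \<open>Everything is divided by \<open>j = (i + e)^2\<close>. Then \<open>n / j\<close> tends
  to \<open>2 - 2 / d\<close>, and the \<open>i\<close> rounds are negligible because
  \<open>j\<close> grows quadratically. The limit \<open>2 / (2 - 2 / d) + 1.5\<close> is the
  claimed ratio.\<close>

lemma tendsto_hard_ratio:
  fixes d :: real and e :: nat and n :: "nat \<Rightarrow> nat"
  assumes d: "2 \<le> d" and e: "2 \<le> e"
    and n: "\<And>i. n i = (i + e)\<^sup>2 + nat \<lfloor>(1 - 2 / d) * real ((i + e)\<^sup>2)\<rfloor> + 2"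
  shows "(\<lambda>i. (2 * real ((i + e)\<^sup>2) + 1.5 * real (n i) * (1 - (1 / 3) ^ i) - 1) / real (n i + i))
    \<longlonglongrightarrow> 1.5 + d / (d - 1)"
proof -
  define j where "j = (\<lambda>i. (i + e)\<^sup>2)"
  define q where "q = (\<lambda>i. nat \<lfloor>(1 - 2 / d) * real (j i)\<rfloor>)"
  have n_eq: "n i = j i + q i + 2" for i by (simp add: n j_def q_def)
  have j_pos: "0 < j i" for i using e by (simp add: j_def)
  have j_ge: "(i + 1) * (i + 1) \<le> j i" for i
    using e mult_mono[of "i + 1" "i + e" "i + 1" "i + e"] by (simp add: j_def power2_eq_square)
  have q_bounds: "real (q i) \<le> (1 - 2 / d) * real (j i)" "(1 - 2 / d) * real (j i) - 1 \<le> real (q i)" for i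
  proof -
    have "0 \<le> (1 - 2 / d) * real (j i)" using d by simp
    thus "real (q i) \<le> (1 - 2 / d) * real (j i)" "(1 - 2 / d) * real (j i) - 1 \<le> real (q i)"
      unfolding q_def by linarith+
  qed
  have i_j: "real i / real (j i) \<le> 1 / real (Suc i)" and one_j: "1 / real (j i) \<le> 1 / real (Suc i)" for i
  proof -
    have ge: "real (Suc i) * real (Suc i) \<le> real (j i)"
      using j_ge[of i] by (metis Suc_eq_plus1 of_nat_le_iff of_nat_mult)
    have "real i * real (Suc i) \<le> real (Suc i) * real (Suc i)" by (intro mult_right_mono) auto
    hence "real i * real (Suc i) \<le> real (j i)" using ge by linarith
    thus "real i / real (j i) \<le> 1 / real (Suc i)"
      using j_pos[of i] by (simp add: field_simps)
    have "1 * real (Suc i) \<le> real (j i)"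
      by (rule order_trans[OF mult_right_mono ge]) auto
    hence "real (Suc i) \<le> real (j i)" by (simp only: mult_1_left)
    thus "1 / real (j i) \<le> 1 / real (Suc i)"
      by (intro divide_left_mono) (use j_pos[of i] in auto)
  qed
  have lim_Suc: "(\<lambda>i. 1 / real (Suc i)) \<longlonglongrightarrow> 0"
    using LIMSEQ_inverse_real_of_nat by (simp add: inverse_eq_divide)
  have lim_i: "(\<lambda>i. real i / real (j i)) \<longlonglongrightarrow> 0"
    by (rule tendsto_sandwich[OF _ _ tendsto_const lim_Suc])
      (use i_j in \<open>simp_all del: of_nat_Suc\<close>)
  have lim_1: "(\<lambda>i. 1 / real (j i)) \<longlonglongrightarrow> 0"
    by (rule tendsto_sandwich[OF _ _ tendsto_const lim_Suc])
      (use one_j in \<open>simp_all del: of_nat_Suc\<close>)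
  have lim_q: "(\<lambda>i. real (q i) / real (j i)) \<longlonglongrightarrow> 1 - 2 / d"
  proof (rule tendsto_sandwich)
    show "\<forall>\<^sub>F i in sequentially. (1 - 2 / d) - 1 / real (j i) \<le> real (q i) / real (j i)"
    proof (intro always_eventually allI)
      fix i
      have "((1 - 2 / d) * real (j i) - 1) / real (j i) \<le> real (q i) / real (j i)"
        using q_bounds(2)[of i] by (intro divide_right_mono) auto
      thus "(1 - 2 / d) - 1 / real (j i) \<le> real (q i) / real (j i)"
        using j_pos[of i] by (simp add: diff_divide_distrib)
    qed
    show "\<forall>\<^sub>F i in sequentially. real (q i) / real (j i) \<le> 1 - 2 / d"
      using q_bounds(1) j_pos by (intro always_eventually allI) (simp add: divide_le_eq)
    show "(\<lambda>i. (1 - 2 / d) - 1 / real (j i)) \<longlonglongrightarrow> 1 - 2 / d"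
      using tendsto_diff[OF tendsto_const lim_1, of "1 - 2 / d"] by simp
  qed simp
  have n_j: "real (n i) / real (j i) = 1 + real (q i) / real (j i) + 2 * (1 / real (j i))" for i
    using j_pos[of i] by (simp add: n_eq field_simps)
  have lim_n: "(\<lambda>i. real (n i) / real (j i)) \<longlonglongrightarrow> 2 - 2 / d"
    unfolding n_j
    using tendsto_add[OF tendsto_add[OF tendsto_const lim_q, of 1] tendsto_mult[OF tendsto_const lim_1, of 2]]
    by simp
  have lim_pow: "(\<lambda>i. (1 / 3 :: real) ^ i) \<longlonglongrightarrow> 0"
    by (rule LIMSEQ_realpow_zero) auto
  have "(\<lambda>i. (2 + 1.5 * (real (n i) / real (j i)) * (1 - (1 / 3) ^ i) - 1 / real (j i))
      / (real (n i) / real (j i) + real i / real (j i)))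
    \<longlonglongrightarrow> (2 + 1.5 * (2 - 2 / d) * (1 - 0) - 0) / ((2 - 2 / d) + 0)"
    using d by (intro tendsto_intros lim_n lim_1 lim_i lim_pow) (auto simp: field_simps)
  moreover have "(2 + 1.5 * (2 - 2 / d) * (1 - 0) - 0) / ((2 - 2 / d) + 0) = 1.5 + d / (d - 1)"
    using d by (simp add: field_simps)
  moreover have "(2 + 1.5 * (real (n i) / real (j i)) * (1 - (1 / 3) ^ i) - 1 / real (j i))
      / (real (n i) / real (j i) + real i / real (j i))
    = (2 * real (j i) + 1.5 * real (n i) * (1 - (1 / 3) ^ i) - 1) / real (n i + i)" for i
  proof -
    have "2 + 1.5 * (real (n i) / real (j i)) * (1 - (1 / 3) ^ i) - 1 / real (j i)
        = (2 * real (j i) + 1.5 * real (n i) * (1 - (1 / 3) ^ i) - 1) / real (j i)"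
      using j_pos[of i] by (simp add: add_divide_distrib diff_divide_distrib)
    moreover have "real (n i) / real (j i) + real i / real (j i) = real (n i + i) / real (j i)"
      by (simp add: add_divide_distrib)
    ultimately show ?thesis using j_pos[of i] by simp
  qed
  ultimately show ?thesis unfolding j_def by simp
qed

lemma pseudo_BAF_tight:
  fixes A :: "'c::finite list \<Rightarrow> 'c \<Rightarrow> nat" and d :: real
  assumes A: "is_BAF A" and C: "3 \<le> CARD('c)" and d: "2 \<le> d"
  shows "\<exists>L :: nat \<Rightarrow> 'c item list.
    (\<forall>n. valid_input (L n) \<and> (\<forall>x\<in>set (L n). snd x \<le> 1 / d)) \<and>
    filterlim (\<lambda>n. OPT (L n)) at_top sequentially \<and>
    (\<lambda>n. real (pseudo_BAF A (L n)) / real (OPT (L n))) \<longlonglongrightarrow> 1.5 + d / (d - 1)"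
proof -
  obtain S :: "'c set" where "card S = 3"
    using obtain_subset_with_card_n[OF C] by blast
  then obtain x y z :: 'c where xyz: "x \<noteq> y" "x \<noteq> z" "y \<noteq> z"
    by (auto simp: card_3_iff)
  define r where "r = 1.5 + d / (d - 1)"
  \<comment> \<open>Rounding \<open>d\<close> up ensures \<open>d \<le> (i + e)^2\<close> already
    for \<open>i = 0\<close>, so that grains are no larger than \<open>1 / d\<close>.\<close>
  define e where "e = nat \<lceil>d\<rceil>"
  have e: "d \<le> real e" "2 \<le> e" using d unfolding e_def by linarith+
  define n where "n = (\<lambda>i. (i + e)\<^sup>2 + nat \<lfloor>(1 - 2 / d) * real ((i + e)\<^sup>2)\<rfloor> + 2)"
  have sq: "i + e \<le> (i + e)\<^sup>2" for i
    using e(2) by (simp add: power2_eq_square)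
  have "\<exists>L. valid_input L \<and> (\<forall>u\<in>set L. snd u \<le> 1 / d) \<and> OPT L \<le> n i + i \<and>
      2 * real ((i + e)\<^sup>2) + 1.5 * real (n i) * (1 - (1 / 3) ^ i) \<le> real (pseudo_BAF A L) + 1" for i
  proof (rule hard_instance[OF A xyz d])
    have "real (i + e) \<le> real ((i + e)\<^sup>2)" using sq[of i] of_nat_le_iff by blast
    thus "d \<le> real ((i + e)\<^sup>2)" using e(1) by simp
  qed (simp_all add: n_def)
  then obtain L where L: "\<And>i. valid_input (L i)" "\<And>i u. u \<in> set (L i) \<Longrightarrow> snd u \<le> 1 / d"
    "\<And>i. OPT (L i) \<le> n i + i"
    "\<And>i. 2 * real ((i + e)\<^sup>2) + 1.5 * real (n i) * (1 - (1 / 3) ^ i) \<le> real (pseudo_BAF A (L i)) + 1"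
    by metis
  \<comment> \<open>The competitive bound itself forces the optimum to grow: the cost is at least
    \<open>2 * (i + e) - 1\<close> and at most \<open>3.5 * OPT (L i)\<close>.\<close>
  have OPT_ge: "i + 1 \<le> 2 * OPT (L i)" for i
  proof -
    define v where "v = 1.5 * real (n i) * (1 - (1 / 3) ^ i)"
    define w where "w = real ((i + e)\<^sup>2)"
    have "0 \<le> v"
      by (simp add: v_def power_le_one)
    moreover have "real (i + e) \<le> w" unfolding w_def using sq[of i] of_nat_le_iff by blast
    ultimately have "2 * real (i + e) \<le> 3.5 * real (OPT (L i)) + 1"
      using L(4)[of i, folded v_def w_def] pseudo_BAF_le[OF A L(1)[of i]] by simp
    thus ?thesis using e(2) by simp
  qed
  have lim_OPT: "filterlim (\<lambda>i. OPT (L i)) at_top sequentially"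
  proof (rule filterlim_at_top_mono)
    show "filterlim (\<lambda>i::nat. i div 2) at_top sequentially"
      by (rule filterlim_at_top_div_const_nat) simp
    show "\<forall>\<^sub>F i in sequentially. i div 2 \<le> OPT (L i)"
    proof (intro always_eventually allI)
      show "i div 2 \<le> OPT (L i)" for i using OPT_ge[of i] by linarith
    qed
  qed
  have "(\<lambda>i. real (pseudo_BAF A (L i)) / real (OPT (L i))) \<longlonglongrightarrow> r"
  proof (rule tendsto_sandwich)
    show "\<forall>\<^sub>F i in sequentially.
        (2 * real ((i + e)\<^sup>2) + 1.5 * real (n i) * (1 - (1 / 3) ^ i) - 1) / real (n i + i)
          \<le> real (pseudo_BAF A (L i)) / real (OPT (L i))"
    proof (intro always_eventually allI)
      fix i
      have "(2 * real ((i + e)\<^sup>2) + 1.5 * real (n i) * (1 - (1 / 3) ^ i) - 1) / real (n i + i)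
          \<le> real (pseudo_BAF A (L i)) / real (n i + i)"
        using L(4)[of i] by (intro divide_right_mono) auto
      also have "\<dots> \<le> real (pseudo_BAF A (L i)) / real (OPT (L i))"
        using L(3)[of i] OPT_ge[of i] by (intro divide_left_mono) auto
      finally show "(2 * real ((i + e)\<^sup>2) + 1.5 * real (n i) * (1 - (1 / 3) ^ i) - 1) / real (n i + i)
          \<le> real (pseudo_BAF A (L i)) / real (OPT (L i))" .
    qed
    show "(\<lambda>i. (2 * real ((i + e)\<^sup>2) + 1.5 * real (n i) * (1 - (1 / 3) ^ i) - 1) / real (n i + i))
        \<longlonglongrightarrow> r"
      unfolding r_def by (rule tendsto_hard_ratio[OF d e(2)]) (simp add: n_def)
    \<comment> \<open>The upper bound for small items loses less than one bin to the ceiling, that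
      is, at most \<open>1 / OPT\<close> in the ratio.\<close>
    show "\<forall>\<^sub>F i in sequentially. real (pseudo_BAF A (L i)) / real (OPT (L i)) \<le> r + 1 / real (OPT (L i))"
    proof (intro always_eventually allI)
      fix i
      have pos: "0 < real (OPT (L i))" using OPT_ge[of i] by simp
      have "int (pseudo_BAF A (L i)) \<le> \<lceil>r * real (OPT (L i))\<rceil>"
        unfolding r_def by (rule pseudo_BAF_le_small[OF A L(1) d]) (rule L(2))
      hence "real (pseudo_BAF A (L i)) \<le> r * real (OPT (L i)) + 1"
        by linarith
      thus "real (pseudo_BAF A (L i)) / real (OPT (L i)) \<le> r + 1 / real (OPT (L i))"
        using pos by (simp add: field_simps)
    qed
    have "filterlim (\<lambda>i. real (OPT (L i))) at_top sequentially"
      by (rule filterlim_compose[OF filterlim_real_sequentially lim_OPT])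
    hence "(\<lambda>i. 1 / real (OPT (L i))) \<longlonglongrightarrow> 0"
      by (rule tendsto_divide_0[OF tendsto_const filterlim_at_top_imp_at_infinity])
    thus "(\<lambda>i. r + 1 / real (OPT (L i))) \<longlonglongrightarrow> r"
      using tendsto_add[OF tendsto_const, of _ 0 sequentially r] by simp
  qed
  thus ?thesis using L(1,2) lim_OPT unfolding r_def by (intro exI[of _ L]) auto
qed

theorem theorem4p4:
  fixes A :: "'c::finite list \<Rightarrow> 'c \<Rightarrow> nat"
  assumes "is_BAF A"
  shows "(\<forall>L. valid_input L \<longrightarrow> real (pseudo_BAF A L) \<le> 3.5 * real (OPT L)) \<and>
    (\<forall>d::real. 2 \<le> d \<longrightarrow>
      (\<forall>L. valid_input L \<and> (\<forall>x\<in>set L. snd x \<le> 1 / d) \<longrightarrow>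
        int (pseudo_BAF A L) \<le> \<lceil>(1.5 + d / (d - 1)) * real (OPT L)\<rceil>)) \<and>
    (3 \<le> CARD('c) \<longrightarrow>
      (\<exists>L :: nat \<Rightarrow> 'c item list.
        (\<forall>n. valid_input (L n)) \<and>
        filterlim (\<lambda>n. OPT (L n)) at_top sequentially \<and>
        (\<lambda>n. real (pseudo_BAF A (L n)) / real (OPT (L n))) \<longlonglongrightarrow> 3.5) \<and>
      (\<forall>d::real. 2 \<le> d \<longrightarrow>
        (\<exists>L :: nat \<Rightarrow> 'c item list.
          (\<forall>n. valid_input (L n) \<and> (\<forall>x\<in>set (L n). snd x \<le> 1 / d)) \<and>
          filterlim (\<lambda>n. OPT (L n)) at_top sequentially \<and>
          (\<lambda>n. real (pseudo_BAF A (L n)) / real (OPT (L n))) \<longlonglongrightarrow> 1.5 + d / (d - 1))))"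
proof (intro conjI allI impI)
  show "real (pseudo_BAF A L) \<le> 3.5 * real (OPT L)" if "valid_input L" for L
    using pseudo_BAF_le[OF assms that] .
  show "int (pseudo_BAF A L) \<le> \<lceil>(1.5 + d / (d - 1)) * real (OPT L)\<rceil>"
    if "2 \<le> d" "valid_input L \<and> (\<forall>x\<in>set L. snd x \<le> 1 / d)" for d :: real and L
    using that by (intro pseudo_BAF_le_small[OF assms]) auto
  assume C: "3 \<le> CARD('c)"
  have "(1.5 :: real) + 2 / (2 - 1) = 3.5" by simp
  thus "\<exists>L :: nat \<Rightarrow> 'c item list. (\<forall>n. valid_input (L n)) \<and>
      filterlim (\<lambda>n. OPT (L n)) at_top sequentially \<and>
      (\<lambda>n. real (pseudo_BAF A (L n)) / real (OPT (L n))) \<longlonglongrightarrow> 3.5"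
    using pseudo_BAF_tight[OF assms C, of 2] by auto
  show "\<exists>L :: nat \<Rightarrow> 'c item list.
      (\<forall>n. valid_input (L n) \<and> (\<forall>x\<in>set (L n). snd x \<le> 1 / d)) \<and>
      filterlim (\<lambda>n. OPT (L n)) at_top sequentially \<and>
      (\<lambda>n. real (pseudo_BAF A (L n)) / real (OPT (L n))) \<longlonglongrightarrow> 1.5 + d / (d - 1)"
    if "2 \<le> d" for d :: real
    using pseudo_BAF_tight[OF assms C that] .
qed

end
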